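(* There exists an absolute constant $C>0$ such that for all real $r>2$, all $\beta\in\mathbb{R}$ and all $n\in\mathbb{N}$ (with $n\ge 1$), $$ \mathcal{E}_n(W^r_{\beta,1})=\frac{1}{n^r}\left(\frac{1}{\pi\left(1-e^{-r/n}\right)}+\eta\,\delta_{r,n}\right) $$ for some real number $\eta=\eta_{r,n,\beta}$ with $|\eta|\le C$ (that is, $\eta$ is a quantity $\mathcal{O}(1)$ bounded uniformly in all the parameters $r,n,\beta$), where $\delta_{r,1}:=e^{-r}$ and, for $n\ge 2$, $$ \delta_{r,n}:=\begin{cases}\dfrac{n}{r(r-2)}, & 2<r\le n+1,\\[2mm] \dfrac{r}{n^2}\,e^{-r/n}, & n+1\le r\le n^2,\\[2mm] \left(1+\dfrac1n\right)^{-r}, & r\ge n^2.\end{cases} $$ At the overlapping endpoints $r=n+1$ and $r=n^2$ the formula holds with either of the two applicable expressions for $\delta_{r,n}$.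
   Context: Functions are real-valued and $2\pi$-periodic. $L_1$ is the space of $2\pi$-periodic functions summable on $[-\pi,\pi)$ with (unnormalized) norm $\|\varphi\|_1=\int_{-\pi}^{\pi}|\varphi(t)|\,dt$. For $r>0$ and $\beta\in\mathbb{R}$ the Weyl--Nagy kernel is $$B_{r,\beta}(t)=\sum_{k=1}^{\infty}k^{-r}\cos\left(kt-\frac{\beta\pi}{2}\right).$$ The Weyl--Nagy class $W^r_{\beta,1}$ is the set of all $2\pi$-periodic functions $f$ of the form $$f(x)=\frac{a_0}{2}+\frac1\pi\int_{-\pi}^{\pi}\varphi(x-t)B_{r,\beta}(t)\,dt,$$ where $a_0\in\mathbb{R}$, $\varphi\in L_1$, $\|\varphi\|_1\le 1$ and $\int_{-\pi}^{\pi}\varphi(t)\,dt=0$. For $r>2$ these functions are continuous. For $n\in\mathbb{N}$, $S_{n-1}(f;x)=\frac{a_0}{2}+\sum_{k=1}^{n-1}(a_k\cos kx+b_k\sin kx)$ is the partial Fourier sum of order $n-1$ of $f$, with $a_k=\frac1\pi\int_{-\pi}^{\pi}f(t)\cos kt\,dt$, $b_k=\frac1\pi\int_{-\pi}^{\pi}f(t)\sin kt\,dt$. Define $$\mathcal{E}_n(W^r_{\beta,1}):=\sup_{f\in W^r_{\beta,1}}|f(x)-S_{n-1}(f;x)|;$$ since the class is invariant under shifts of the argument, this quantity does not depend on $x\in\mathbb{R}$. *)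

theory Defs
  imports "HOL-Analysis.Analysis" "HOL-Library.Periodic_Fun"
begin

definition L1_periodic :: "(real \<Rightarrow> real) set" where
  "L1_periodic = {\<phi>. periodic_fun_simple \<phi> (2 * pi) \<and> set_integrable lebesgue {-pi..pi} \<phi>}"

definition L1_norm :: "(real \<Rightarrow> real) \<Rightarrow> real" where
  "L1_norm \<phi> = (LINT t:{-pi..pi}|lebesgue. \<bar>\<phi> t\<bar>)"

text \<open>The summation index is shifted, so that the series starts at frequency one. It converges
  absolutely for \<open>r > 1\<close>.\<close>

definition weyl_nagy_kernel :: "real \<Rightarrow> real \<Rightarrow> real \<Rightarrow> real" where
  "weyl_nagy_kernel r \<beta> t =
     (\<Sum>k. real (Suc k) powr (-r) * cos (real (Suc k) * t - \<beta> * pi / 2))"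

definition weyl_nagy_class :: "real \<Rightarrow> real \<Rightarrow> (real \<Rightarrow> real) set" where
  "weyl_nagy_class r \<beta> =
     {f. periodic_fun_simple f (2 * pi) \<and>
         (\<exists>a0. \<exists>\<phi>\<in>L1_periodic. L1_norm \<phi> \<le> 1 \<and> (LINT t:{-pi..pi}|lebesgue. \<phi> t) = 0 \<and>
           (\<forall>x. f x = a0 / 2 +
              1 / pi * (LINT t:{-pi..pi}|lebesgue. \<phi> (x - t) * weyl_nagy_kernel r \<beta> t)))}"

definition fourier_cos_coeff :: "(real \<Rightarrow> real) \<Rightarrow> nat \<Rightarrow> real" where
  "fourier_cos_coeff f k = 1 / pi * (LINT t:{-pi..pi}|lebesgue. f t * cos (real k * t))"

definition fourier_sin_coeff :: "(real \<Rightarrow> real) \<Rightarrow> nat \<Rightarrow> real" where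
  "fourier_sin_coeff f k = 1 / pi * (LINT t:{-pi..pi}|lebesgue. f t * sin (real k * t))"

definition fourier_partial_sum :: "nat \<Rightarrow> (real \<Rightarrow> real) \<Rightarrow> real \<Rightarrow> real" where
  "fourier_partial_sum m f x = fourier_cos_coeff f 0 / 2 +
     (\<Sum>k=1..m. fourier_cos_coeff f k * cos (real k * x) + fourier_sin_coeff f k * sin (real k * x))"

text \<open>The supremum is taken in the extended reals, so that equating it with a real number
  includes the claim that it is finite. The point \<open>x\<close> is kept as an argument; independence of \<open>x\<close>
  is not built into the definition.\<close>

definition fourier_sup_deviation :: "nat \<Rightarrow> (real \<Rightarrow> real) set \<Rightarrow> real \<Rightarrow> ereal" where
  "fourier_sup_deviation n W x = (SUP f\<in>W. ereal \<bar>f x - fourier_partial_sum (n - 1) f x\<bar>)"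

text \<open>A relation rather than a function: for \<open>n \<ge> 2\<close> the cases overlap at \<open>r = n + 1\<close> and
  \<open>r = n\<^sup>2\<close>, where both expressions are admissible values.\<close>

inductive remainder_order :: "real \<Rightarrow> nat \<Rightarrow> real \<Rightarrow> bool" where
  one: "remainder_order r 1 (exp (-r))"
| small: "n \<ge> 2 \<Longrightarrow> 2 < r \<Longrightarrow> r \<le> real n + 1 \<Longrightarrow>
    remainder_order r n (real n / (r * (r - 2)))"
| medium: "n \<ge> 2 \<Longrightarrow> real n + 1 \<le> r \<Longrightarrow> r \<le> (real n)\<^sup>2 \<Longrightarrow>
    remainder_order r n (r / (real n)\<^sup>2 * exp (- r / real n))"
| large: "n \<ge> 2 \<Longrightarrow> (real n)\<^sup>2 \<le> r \<Longrightarrow>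
    remainder_order r n ((1 + 1 / real n) powr (-r))"

lemma remainder_order_exists:
  assumes "2 < r" "n \<ge> 1"
  shows "\<exists>\<delta>. remainder_order r n \<delta>"
proof (cases "n = 1")
  case True
  then show ?thesis using remainder_order.one by blast
next
  case False
  with assms have "n \<ge> 2" by simp
  then show ?thesis
    using remainder_order.small[of n r] remainder_order.medium[of n r] remainder_order.large[of n r]
      assms(1) linear by blast
qed

end

(*
  f - S_{n-1} f is the convolution of phi / pi with the kernel tail T(t) = sum_{k >= n} k^(-r) cos(k t - theta),
  theta = beta pi / 2. As phi has mean zero and L1 norm at most 1, testing with differences of
  approximate point masses shows that the supremum is (sup T - inf T) / (2 pi), whatever x is.

  Write n^r T(t) = sum_k a_k cos((n + k) t - theta) with a_k = (1 + k/n)^(-r). Half the oscillation is at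
  most sum a_k. Points t with |t| <= pi/n and n t = theta or theta + pi modulo 2 pi give the values
  sum a_k cos(k t) and -sum a_k cos(k t), so only sum a_k (1 - cos(k t)) is lost. Finally sum a_k is
  compared term by term with the geometric series of exp(-r/n).
*)
theory Submission
  imports Defs
begin

section \<open>Integration over a period\<close>

text \<open>Both losses named in the overview are governed by one sum. With x = k/n, the phase loss
  1 - cos (k t) and the difference x - ln (1 + x), which separates a_k from exp (-r x), are O(x^2 /
  (1 + x)). Hence half the oscillation, scaled by n^r, differs from the geometric sum by at most 6 r
  W, where W is the sum of \<open>dilated_weight\<close>. For r <= n + 1, W is compared with an
  integral, which produces the pole at r = 2; for n + 1 <= r <= n^2 its term k = 1 dominates. For r
  >= n^2 this bound is too large by a factor of order r / n^2, and both quantities are instead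
  compared with their common leading term 1.\<close>

abbreviation circle :: "real measure" where "circle \<equiv> lebesgue_on {-pi..pi}"

lemma set_integrable_circle: "set_integrable lebesgue {-pi..pi} f \<longleftrightarrow> integrable circle f"
  for f :: "real \<Rightarrow> real"
  by (simp add: set_integrable_def integrable_restrict_space)

lemma set_integral_circle: "set_lebesgue_integral lebesgue {-pi..pi} f = integral\<^sup>L circle f"
  for f :: "real \<Rightarrow> real"
  by (simp add: set_lebesgue_integral_def integral_restrict_space)

text \<open>Bridge to the gauge integral, where intervals can be split, translated and reflected.
  Lebesgue integrability is absolute gauge integrability, so such a manipulation has to be applied
  to f and to its absolute value.\<close>

lemma circle_integrable_HK:
  "integrable circle f \<longleftrightarrow> f integrable_on {-pi..pi} \<and> (\<lambda>x. \<bar>f x\<bar>) integrable_on {-pi..pi}"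
  for f :: "real \<Rightarrow> real"
  by (simp add: set_integrable_circle[symmetric] absolutely_integrable_on_def)

lemma circle_integral_HK: "integrable circle f \<Longrightarrow> integral\<^sup>L circle f = integral {-pi..pi} f"
  for f :: "real \<Rightarrow> real"
  by (simp add: set_integral_circle[symmetric] set_integrable_circle[symmetric] set_lebesgue_integral_eq_integral)

lemma finite_measure_circle: "finite_measure circle"
  by (rule finite_measure_lebesgue_on) simp

lemma periodic_simple_plus_int:
  fixes h :: "real \<Rightarrow> real"
  assumes "periodic_fun_simple h p"
  shows "h (x + of_int k * p) = h x"
proof -
  interpret periodic_fun_simple h p by fact
  show ?thesis using plus_of_int[of x k] by simp
qed

text \<open>Only c modulo p matters. After reduction to 0 <= c' <= p, the shifted interval overhangs
  \<open>{a..a+p}\<close> by \<open>{a+p..a+c'+p}\<close>, whose integral is that of the missing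
  piece \<open>{a..a+c'}\<close> one period earlier.\<close>

lemma has_integral_periodic_shift:
  fixes h :: "real \<Rightarrow> real"
  assumes per: "periodic_fun_simple h p" and p: "p > 0" and h: "(h has_integral I) {a..a+p}"
  shows "((\<lambda>t. h (c + t)) has_integral I) {a..a+p}"
proof -
  define c' where "c' = c - of_int \<lfloor>c / p\<rfloor> * p"
  have c': "0 \<le> c'" "c' \<le> p"
    using p floor_divide_lower[of p c] floor_divide_upper[of p c]
    by (auto simp: c'_def algebra_simps)
  have eq: "h (c + t) = h (c' + t)" for t
    using periodic_simple_plus_int[OF per, of "c' + t" "\<lfloor>c / p\<rfloor>"] by (simp add: c'_def algebra_simps)
  have hp: "h \<circ> (+) p = h"
    using periodic_simple_plus_int[OF per, of _ 1] by (auto simp: o_def add.commute)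
  have int: "h integrable_on {a..a+p}" using h by blast
  have 1: "(h has_integral integral {a..a+c'} h) {a..a+c'}"
    using c' by (intro integrable_integral integrable_subinterval_real[OF int]) auto
  have 2: "(h has_integral integral {a+c'..a+p} h) {a+c'..a+p}"
    using c' by (intro integrable_integral integrable_subinterval_real[OF int]) auto
  have "(h has_integral integral {a..a+c'} h + integral {a+c'..a+p} h) {a..a+p}"
    by (rule has_integral_combine[OF _ _ 1 2]) (use c' in auto)
  from has_integral_unique[OF h this] have I: "I = integral {a+c'..a+p} h + integral {a..a+c'} h"
    by simp
  have 3: "(h has_integral integral {a..a+c'} h) {a+p..a+c'+p}"
    using 1 has_integral_shift_Icc_real[of h p _ a "a+c'"] hp by simp
  have "(h has_integral I) {a+c'..a+c'+p}"
    unfolding I by (rule has_integral_combine[OF _ _ 2 3]) (use c' in auto)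
  hence "(h \<circ> (+) c' has_integral I) {a..a+p}"
    by (subst has_integral_shift_Icc_real) (simp add: algebra_simps)
  thus ?thesis by (simp add: o_def eq)
qed

lemma periodic_compose_abs: "periodic_fun_simple h p \<Longrightarrow> periodic_fun_simple (\<lambda>x. \<bar>h x\<bar>) p"
  for h :: "real \<Rightarrow> real"
  by (simp add: periodic_fun_simple_def)

lemma circle_shift:
  fixes h :: "real \<Rightarrow> real"
  assumes per: "periodic_fun_simple h (2*pi)" and h: "integrable circle h"
  shows "integrable circle (\<lambda>t. h (c + t))" "integral\<^sup>L circle (\<lambda>t. h (c + t)) = integral\<^sup>L circle h"
proof -
  have *: "((\<lambda>t. g (c + t)) has_integral integral {-pi..pi} g) {-pi..pi}"
    if "periodic_fun_simple g (2*pi)" "g integrable_on {-pi..pi}" for g :: "real \<Rightarrow> real"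
    using has_integral_periodic_shift[OF that(1) _ , of "integral {-pi..pi} g" "-pi" c] that(2)
    by (simp add: integrable_integral)
  from h have "h integrable_on {-pi..pi}" "(\<lambda>x. \<bar>h x\<bar>) integrable_on {-pi..pi}"
    by (auto simp: circle_integrable_HK)
  note a = *[OF per this(1)] *[OF periodic_compose_abs[OF per] this(2)]
  show int: "integrable circle (\<lambda>t. h (c + t))"
    unfolding circle_integrable_HK using a by blast
  show "integral\<^sup>L circle (\<lambda>t. h (c + t)) = integral\<^sup>L circle h"
    using a(1) by (simp add: circle_integral_HK int h integral_unique)
qed

lemma circle_reflect:
  fixes h :: "real \<Rightarrow> real"
  assumes per: "periodic_fun_simple h (2*pi)" and h: "integrable circle h"
  shows "integrable circle (\<lambda>t. h (c - t))" "integral\<^sup>L circle (\<lambda>t. h (c - t)) = integral\<^sup>L circle h"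
  using integrable_reflect_real[of pi "-pi" "\<lambda>t. h (c + t)"] integral_reflect_real[of pi "-pi" "\<lambda>t. h (c + t)"]
    circle_shift[OF per h, of c]
  by auto

lemma circle_continuous_measurable: "continuous_on UNIV g \<Longrightarrow> g \<in> borel_measurable circle"
  for g :: "real \<Rightarrow> real"
  by (rule continuous_imp_measurable_on_sets_lebesgue) (auto intro: continuous_on_subset)

lemma circle_integrable_mult:
  fixes \<phi> g :: "real \<Rightarrow> real"
  assumes "integrable circle \<phi>" "g \<in> borel_measurable circle" "\<And>t. \<bar>g t\<bar> \<le> K"
  shows "integrable circle (\<lambda>t. \<phi> t * g t)"
proof (rule Bochner_Integration.integrable_bound[where f = "\<lambda>t. K * \<bar>\<phi> t\<bar>"])
  show "AE x in circle. norm (\<phi> x * g x) \<le> norm (K * \<bar>\<phi> x\<bar>)"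
  proof (intro AE_I2)
    fix x
    have "\<bar>g x\<bar> * \<bar>\<phi> x\<bar> \<le> \<bar>K\<bar> * \<bar>\<phi> x\<bar>"
      using assms(3)[of x] by (intro mult_right_mono) auto
    thus "norm (\<phi> x * g x) \<le> norm (K * \<bar>\<phi> x\<bar>)"
      by (simp add: abs_mult mult.commute)
  qed
qed (use assms in auto)

lemma circle_integrable_bounded:
  fixes g :: "real \<Rightarrow> real"
  assumes "g \<in> borel_measurable circle" "\<And>t. \<bar>g t\<bar> \<le> K"
  shows "integrable circle g"
proof -
  interpret finite_measure circle by (rule finite_measure_circle)
  show ?thesis using assms by (intro integrable_const_bound[where B = K]) auto
qed

lemma measure_circle [simp]: "measure circle {-pi..pi} = 2 * pi"
  by (simp add: measure_restrict_space)

lemma integral_circle_cos_int: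
  fixes m :: int
  shows "integral\<^sup>L circle (\<lambda>t. cos (of_int m * t)) = (if m = 0 then 2 * pi else 0)"
proof (cases "m = 0")
  case False
  have int: "integrable circle (\<lambda>t. cos (of_int m * t))"
    by (rule circle_integrable_bounded[where K = 1])
       (auto intro!: circle_continuous_measurable continuous_intros)
  have "((\<lambda>t. cos (of_int m * t)) has_integral
          sin (of_int m * pi) / of_int m - sin (of_int m * (-pi)) / of_int m) {-pi..pi}"
    using False
    by (intro fundamental_theorem_of_calculus)
       (auto intro!: derivative_eq_intros simp: has_real_derivative_iff_has_vector_derivative[symmetric])
  hence "integral {-pi..pi} (\<lambda>t. cos (of_int m * t)) = 0"
    using sin_zero_iff_int2[of "of_int m * pi"] by (simp add: integral_unique)
  thus ?thesis using False int by (simp add: circle_integral_HK)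
qed simp

lemma integral_circle_sin_int:
  fixes m :: int
  shows "integral\<^sup>L circle (\<lambda>t. sin (of_int m * t)) = 0"
proof -
  have "integral\<^sup>L circle (\<lambda>t. sin (of_int m * (-t))) = integral\<^sup>L circle (\<lambda>t. sin (of_int m * t))"
    using integral_reflect_real[of pi "-pi" "\<lambda>t. sin (of_int m * t)"] by simp
  thus ?thesis by simp
qed

lemma circle_trig_integrable [simp]:
  "integrable circle (\<lambda>t. cos (c * t + d))" "integrable circle (\<lambda>t. sin (c * t + d))"
  "integrable circle (\<lambda>t. cos (c * t))" "integrable circle (\<lambda>t. sin (c * t))"
  by (rule circle_integrable_bounded[where K = 1];
      auto intro!: circle_continuous_measurable continuous_intros)+

lemma circle_orthogonality:
  fixes j k :: nat
  assumes "k \<ge> 1"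
  shows "integral\<^sup>L circle (\<lambda>t. cos (real k * t) * cos (real j * t)) = (if j = k then pi else 0)"
    and "integral\<^sup>L circle (\<lambda>t. sin (real k * t) * cos (real j * t)) = 0"
    and "integrable circle (\<lambda>t. cos (real k * t) * cos (real j * t))"
    and "integrable circle (\<lambda>t. sin (real k * t) * cos (real j * t))"
proof -
  have c: "cos (real k * t) * cos (real j * t) =
      cos (of_int (int k - int j) * t) / 2 + cos (of_int (int k + int j) * t) / 2" for t
    by (simp add: left_diff_distrib distrib_right cos_diff cos_add field_simps)
  have s: "sin (real k * t) * cos (real j * t) =
      sin (of_int (int k + int j) * t) / 2 + sin (of_int (int k - int j) * t) / 2" for t
    by (simp add: left_diff_distrib distrib_right sin_diff sin_add field_simps)
  have i: "integral\<^sup>L circle (\<lambda>t. cos (of_int a * t) / 2 + cos (of_int b * t) / 2) =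
      integral\<^sup>L circle (\<lambda>t. cos (of_int a * t)) / 2 + integral\<^sup>L circle (\<lambda>t. cos (of_int b * t)) / 2"
    "integral\<^sup>L circle (\<lambda>t. sin (of_int a * t) / 2 + sin (of_int b * t) / 2) =
      integral\<^sup>L circle (\<lambda>t. sin (of_int a * t)) / 2 + integral\<^sup>L circle (\<lambda>t. sin (of_int b * t)) / 2"
    for a b :: int
    by (subst Bochner_Integration.integral_add; simp)+
  show "integral\<^sup>L circle (\<lambda>t. cos (real k * t) * cos (real j * t)) = (if j = k then pi else 0)"
    using assms unfolding c i integral_circle_cos_int by auto
  show "integral\<^sup>L circle (\<lambda>t. sin (real k * t) * cos (real j * t)) = 0"
    unfolding s i integral_circle_sin_int by auto
  show "integrable circle (\<lambda>t. cos (real k * t) * cos (real j * t))"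
    "integrable circle (\<lambda>t. sin (real k * t) * cos (real j * t))"
    unfolding c s by (intro Bochner_Integration.integrable_add integrable_divide_zero; simp)+
qed

section \<open>Remainders of Fourier sums and the kernel tail\<close>

definition kernel_tail :: "real \<Rightarrow> real \<Rightarrow> nat \<Rightarrow> real \<Rightarrow> real" where
  "kernel_tail r \<theta> n t = (\<Sum>k. real (n + k) powr (-r) * cos (real (n + k) * t - \<theta>))"

lemma weyl_nagy_kernel_eq_tail: "weyl_nagy_kernel r \<beta> = kernel_tail r (\<beta> * pi / 2) 1"
  by (simp add: fun_eq_iff weyl_nagy_kernel_def kernel_tail_def)

lemma summable_powr_shift:
  assumes "r > 1"
  shows "summable (\<lambda>k. real (n + k) powr (-r))"
proof -
  have "summable (\<lambda>k. real k powr (-r))"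
    using assms by (simp add: summable_real_powr_iff)
  from summable_ignore_initial_segment[OF this, of n] show ?thesis
    by (simp add: add.commute)
qed

lemma kernel_term_bound: "\<bar>real (n + k) powr (-r) * cos y\<bar> \<le> real (n + k) powr (-r)"
  by (simp add: abs_mult mult_left_le)

lemma summable_kernel_terms:
  assumes "r > 1"
  shows "summable (\<lambda>k. real (n + k) powr (-r) * cos (f k))"
    "summable (\<lambda>k. \<bar>real (n + k) powr (-r) * cos (f k)\<bar>)"
  by (rule summable_comparison_test'[OF summable_powr_shift[OF assms, of n]],
      use kernel_term_bound in auto)+

lemma kernel_tail_periodic: "periodic_fun_simple (kernel_tail r \<theta> n) (2 * pi)"
proof
  fix t
  have "cos (real (n + k) * (t + 2 * pi) - \<theta>) = cos (real (n + k) * t - \<theta>)" for k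
    using cos.plus_of_nat[of "real (n + k) * t - \<theta>" "n + k"] by (simp add: algebra_simps)
  thus "kernel_tail r \<theta> n (t + 2 * pi) = kernel_tail r \<theta> n t"
    by (simp add: kernel_tail_def)
qed

lemma kernel_tail_continuous:
  assumes "r > 1"
  shows "continuous_on UNIV (kernel_tail r \<theta> n)"
proof -
  have "uniform_limit UNIV (\<lambda>N t. \<Sum>k<N. real (n + k) powr (-r) * cos (real (n + k) * t - \<theta>))
          (\<lambda>t. \<Sum>k. real (n + k) powr (-r) * cos (real (n + k) * t - \<theta>)) sequentially"
    by (rule Weierstrass_m_test[OF _ summable_powr_shift[OF assms, of n]])
       (use kernel_term_bound in auto)
  hence "continuous_on UNIV (\<lambda>t. \<Sum>k. real (n + k) powr (-r) * cos (real (n + k) * t - \<theta>))"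
    by (rule uniform_limit_theorem[rotated]) (auto intro!: always_eventually continuous_intros)
  thus ?thesis by (simp add: kernel_tail_def[abs_def])
qed

lemma kernel_tail_bound:
  assumes "r > 1"
  shows "\<bar>kernel_tail r \<theta> n t\<bar> \<le> (\<Sum>k. real (n + k) powr (-r))"
  unfolding kernel_tail_def
  by (rule order_trans[OF summable_rabs[OF summable_kernel_terms(2)[OF assms]]])
     (intro suminf_le kernel_term_bound summable_kernel_terms summable_powr_shift assms)

lemma L1_periodic_iff:
  "\<phi> \<in> L1_periodic \<longleftrightarrow> periodic_fun_simple \<phi> (2 * pi) \<and> integrable circle \<phi>"
  by (simp add: L1_periodic_def set_integrable_circle)

lemma L1_norm_circle: "L1_norm \<phi> = integral\<^sup>L circle (\<lambda>t. \<bar>\<phi> t\<bar>)"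
  by (simp add: L1_norm_def set_integral_circle)

lemma periodic_mult: "periodic_fun_simple f p \<Longrightarrow> periodic_fun_simple g p \<Longrightarrow>
    periodic_fun_simple (\<lambda>x. f x * g x) p" for f g :: "real \<Rightarrow> real"
  by (simp add: periodic_fun_simple_def)

lemma periodic_reflect:
  fixes f :: "real \<Rightarrow> real"
  assumes "periodic_fun_simple f p"
  shows "periodic_fun_simple (\<lambda>x. f (c - x)) p"
proof
  fix x
  show "f (c - (x + p)) = f (c - x)"
    using periodic_simple_plus_int[OF assms, of "c - x" "-1"] by (simp add: algebra_simps)
qed

lemma periodic_cos_nat: "periodic_fun_simple (\<lambda>x. cos (real j * x)) (2 * pi)"
proof
  fix x show "cos (real j * (x + 2 * pi)) = cos (real j * x)"
    using cos.plus_of_nat[of "real j * x" j] by (simp add: algebra_simps)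
qed

lemma measurable_reflect_continuous:
  "continuous_on UNIV g \<Longrightarrow> (\<lambda>u. g (x - u)) \<in> borel_measurable circle" for g :: "real \<Rightarrow> real"
  by (rule circle_continuous_measurable, rule continuous_on_compose2[of UNIV g])
     (auto intro: continuous_intros)

text \<open>Termwise integration is legitimate because the k-th integrand is dominated by
  \<bar>\<phi> u\<bar> times the summable factor (n + k) powr (-r).\<close>

lemma convolution_kernel_tail_sums:
  assumes r: "r > 1" and \<phi>: "integrable circle \<phi>"
  shows "(\<lambda>k. real (n + k) powr (-r) * integral\<^sup>L circle (\<lambda>u. \<phi> u * cos (real (n + k) * (x - u) - \<theta>)))
           sums integral\<^sup>L circle (\<lambda>u. \<phi> u * kernel_tail r \<theta> n (x - u))"
proof -
  define F where "F k u = \<phi> u * (real (n + k) powr (-r) * cos (real (n + k) * (x - u) - \<theta>))" for k u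
  have int: "integrable circle (F k)" for k
    unfolding F_def
    by (rule circle_integrable_mult[OF \<phi> circle_continuous_measurable kernel_term_bound])
       (intro continuous_intros)
  have bd: "norm (F k u) \<le> \<bar>\<phi> u\<bar> * real (n + k) powr (-r)" for k u
    unfolding F_def real_norm_def abs_mult[of "\<phi> u"]
    by (intro mult_left_mono kernel_term_bound) auto
  have sums: "(\<lambda>k. integral\<^sup>L circle (F k)) sums integral\<^sup>L circle (\<lambda>u. \<Sum>k. F k u)"
  proof (rule sums_integral[OF int])
    show "AE u in circle. summable (\<lambda>k. norm (F k u))"
      by (intro AE_I2 summable_comparison_test'[OF summable_mult[OF summable_powr_shift[OF r, of n]]])
         (use bd in auto)
    have "norm (integral\<^sup>L circle (\<lambda>u. norm (F k u))) \<le>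
        integral\<^sup>L circle (\<lambda>u. \<bar>\<phi> u\<bar>) * real (n + k) powr (-r)" for k
    proof -
      have "integral\<^sup>L circle (\<lambda>u. norm (F k u)) \<le> integral\<^sup>L circle (\<lambda>u. \<bar>\<phi> u\<bar> * real (n + k) powr (-r))"
        by (intro integral_mono integrable_norm int bd integrable_mult_left) (use \<phi> in auto)
      thus ?thesis by simp
    qed
    thus "summable (\<lambda>k. integral\<^sup>L circle (\<lambda>u. norm (F k u)))"
      by (intro summable_comparison_test'[OF summable_mult[OF summable_powr_shift[OF r, of n]]])
  qed
  have "(\<Sum>k. F k u) = \<phi> u * kernel_tail r \<theta> n (x - u)" for u
    unfolding F_def kernel_tail_def by (rule suminf_mult[OF summable_kernel_terms(1)[OF r]])
  moreover have "integral\<^sup>L circle (F k) =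
      real (n + k) powr (-r) * integral\<^sup>L circle (\<lambda>u. \<phi> u * cos (real (n + k) * (x - u) - \<theta>))" for k
    unfolding F_def mult.left_commute[of "\<phi> _" "real (n + k) powr (-r)"] by (rule integral_mult_right_zero)
  ultimately show ?thesis using sums by simp
qed

text \<open>For k >= 1 this turns out to be the complete k-th Fourier harmonic, cosine and sine part
  together, of the class member generated by \<phi>.\<close>

definition kernel_harmonic :: "real \<Rightarrow> real \<Rightarrow> (real \<Rightarrow> real) \<Rightarrow> nat \<Rightarrow> real \<Rightarrow> real" where
  "kernel_harmonic r \<theta> \<phi> k x =
     k powr (-r) / pi * integral\<^sup>L circle (\<lambda>u. \<phi> u * cos (real k * (x - u) - \<theta>))"

lemma kernel_harmonic_sums:
  assumes "r > 1" "integrable circle \<phi>"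
  shows "(\<lambda>k. kernel_harmonic r \<theta> \<phi> (n + k) x) sums
           (1 / pi * integral\<^sup>L circle (\<lambda>u. \<phi> u * kernel_tail r \<theta> n (x - u)))"
  using sums_mult[OF convolution_kernel_tail_sums[OF assms, of n x \<theta>], of "1 / pi"]
  by (simp add: kernel_harmonic_def)

lemma kernel_harmonic_bound:
  assumes "integrable circle \<phi>"
  shows "\<bar>kernel_harmonic r \<theta> \<phi> k x\<bar> \<le> real k powr (-r) / pi * integral\<^sup>L circle (\<lambda>u. \<bar>\<phi> u\<bar>)"
proof -
  have "\<bar>integral\<^sup>L circle (\<lambda>u. \<phi> u * cos (real k * (x - u) - \<theta>))\<bar> \<le> integral\<^sup>L circle (\<lambda>u. \<bar>\<phi> u\<bar>)"
  proof (rule order_trans[OF integral_abs_bound], rule integral_mono)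
    show "integrable circle (\<lambda>u. \<bar>\<phi> u * cos (real k * (x - u) - \<theta>)\<bar>)"
      by (intro integrable_abs circle_integrable_mult[OF assms, where K = 1])
         (auto intro!: circle_continuous_measurable continuous_intros)
  qed (use assms in \<open>auto simp: abs_mult mult_left_le\<close>)
  thus ?thesis
    unfolding kernel_harmonic_def abs_mult by (intro mult_mono) auto
qed

text \<open>By the addition theorem the harmonic lies in the span of cos (k t) and sin (k t), and t
  = 0 identifies the cosine coefficient. The sine coefficient stays anonymous: integration against
  an even cos (j t) removes it.\<close>

lemma kernel_harmonic_translate:
  assumes "integrable circle \<phi>"
  obtains b where "\<And>t. kernel_harmonic r \<theta> \<phi> k (x - t) =
    kernel_harmonic r \<theta> \<phi> k x * cos (real k * t) + b * sin (real k * t)"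
proof
  fix t
  have int: "integrable circle (\<lambda>u. \<phi> u * cos (real k * (x - u) - \<theta>))"
    "integrable circle (\<lambda>u. \<phi> u * sin (real k * (x - u) - \<theta>))"
    by (rule circle_integrable_mult[OF assms, where K = 1],
        auto intro!: circle_continuous_measurable continuous_intros)+
  have eq: "\<phi> u * cos (real k * (x - t - u) - \<theta>) =
      \<phi> u * cos (real k * (x - u) - \<theta>) * cos (real k * t) +
      \<phi> u * sin (real k * (x - u) - \<theta>) * sin (real k * t)" for u
  proof -
    have *: "real k * (x - t - u) - \<theta> = (real k * (x - u) - \<theta>) - real k * t"
      by (simp add: algebra_simps)
    show ?thesis unfolding * cos_diff[of "real k * (x - u) - \<theta>"] by (simp only: distrib_left mult.assoc)
  qed
  show "kernel_harmonic r \<theta> \<phi> k (x - t) = kernel_harmonic r \<theta> \<phi> k x * cos (real k * t) +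
     k powr (-r) / pi * integral\<^sup>L circle (\<lambda>u. \<phi> u * sin (real k * (x - u) - \<theta>)) * sin (real k * t)"
  proof -
    have "integral\<^sup>L circle (\<lambda>u. \<phi> u * cos (real k * (x - u) - \<theta>) * cos (real k * t) +
          \<phi> u * sin (real k * (x - u) - \<theta>) * sin (real k * t)) =
        integral\<^sup>L circle (\<lambda>u. \<phi> u * cos (real k * (x - u) - \<theta>)) * cos (real k * t) +
        integral\<^sup>L circle (\<lambda>u. \<phi> u * sin (real k * (x - u) - \<theta>)) * sin (real k * t)"
      using int by simp
    thus ?thesis unfolding kernel_harmonic_def eq by (simp only: distrib_left mult.assoc)
  qed
qed

lemma kernel_harmonic_coefficient:
  assumes \<phi>: "integrable circle \<phi>" and k: "k \<ge> 1"
  shows "integrable circle (\<lambda>t. kernel_harmonic r \<theta> \<phi> k (x - t) * cos (real j * t))"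
    and "integral\<^sup>L circle (\<lambda>t. kernel_harmonic r \<theta> \<phi> k (x - t) * cos (real j * t)) =
           (if j = k then pi * kernel_harmonic r \<theta> \<phi> j x else 0)"
proof -
  obtain b where b: "\<And>t. kernel_harmonic r \<theta> \<phi> k (x - t) =
      kernel_harmonic r \<theta> \<phi> k x * cos (real k * t) + b * sin (real k * t)"
    using kernel_harmonic_translate[OF \<phi>] by blast
  note o = circle_orthogonality[OF k, of j]
  have *: "kernel_harmonic r \<theta> \<phi> k (x - t) * cos (real j * t) =
      kernel_harmonic r \<theta> \<phi> k x * (cos (real k * t) * cos (real j * t)) +
      b * (sin (real k * t) * cos (real j * t))" for t
    by (simp add: b algebra_simps)
  show "integrable circle (\<lambda>t. kernel_harmonic r \<theta> \<phi> k (x - t) * cos (real j * t))"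
    unfolding * by (intro Bochner_Integration.integrable_add integrable_mult_right o)
  have "integral\<^sup>L circle (\<lambda>t. kernel_harmonic r \<theta> \<phi> k (x - t) * cos (real j * t)) =
      kernel_harmonic r \<theta> \<phi> k x * integral\<^sup>L circle (\<lambda>t. cos (real k * t) * cos (real j * t)) +
      b * integral\<^sup>L circle (\<lambda>t. sin (real k * t) * cos (real j * t))"
    unfolding * by (subst Bochner_Integration.integral_add) (auto intro!: integrable_mult_right o)
  thus "integral\<^sup>L circle (\<lambda>t. kernel_harmonic r \<theta> \<phi> k (x - t) * cos (real j * t)) =
           (if j = k then pi * kernel_harmonic r \<theta> \<phi> j x else 0)"
    by (simp add: o)
qed

text \<open>A reflection and the addition theorem turn the whole j-th harmonic at x into one
  convolution, so partial sums can be found without evaluating cosine and sine coefficients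
  separately.\<close>

lemma fourier_term_convolution:
  assumes per: "periodic_fun_simple f (2 * pi)" and f: "integrable circle f"
  shows "fourier_cos_coeff f j * cos (real j * x) + fourier_sin_coeff f j * sin (real j * x) =
           1 / pi * integral\<^sup>L circle (\<lambda>t. f (x - t) * cos (real j * t))"
proof -
  have int: "integrable circle (\<lambda>t. f t * cos (real j * t))" "integrable circle (\<lambda>t. f t * sin (real j * t))"
    "integrable circle (\<lambda>t. f t * cos (real j * (x - t)))"
    by (rule circle_integrable_mult[OF f, where K = 1],
        auto intro!: circle_continuous_measurable continuous_intros)+
  have "integral\<^sup>L circle (\<lambda>t. f (x - t) * cos (real j * t)) =
      integral\<^sup>L circle (\<lambda>t. f t * cos (real j * (x - t)))"
    using circle_reflect(2)[OF periodic_mult[OF per periodic_reflect[OF periodic_cos_nat[of j], of x]] int(3), of x]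
    by simp
  also have "\<dots> = integral\<^sup>L circle (\<lambda>t. f t * cos (real j * t) * cos (real j * x) + f t * sin (real j * t) * sin (real j * x))"
    by (intro Bochner_Integration.integral_cong) (auto simp: right_diff_distrib cos_diff algebra_simps)
  also have "\<dots> = integral\<^sup>L circle (\<lambda>t. f t * cos (real j * t)) * cos (real j * x) +
      integral\<^sup>L circle (\<lambda>t. f t * sin (real j * t)) * sin (real j * x)"
    using int by simp
  finally show ?thesis
    by (simp add: fourier_cos_coeff_def fourier_sin_coeff_def set_integral_circle add_divide_distrib)
qed


text \<open>The series of \<open>kernel_harmonic\<close> converges uniformly to f - a0 / 2, so
  orthogonality, applied term by term, identifies its terms as the Fourier harmonics of f. Removing
  the first n - 1 leaves the frequencies from n on, which sum back to a convolution with the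
  tail.\<close>

lemma weyl_nagy_remainder:
  assumes perf: "periodic_fun_simple f (2 * pi)" and \<phi>L: "\<phi> \<in> L1_periodic"
    and feq: "\<And>x. f x = a0 / 2 +
       1 / pi * (LINT t:{-pi..pi}|lebesgue. \<phi> (x - t) * weyl_nagy_kernel r \<beta> t)"
    and r: "r > 1" and n: "n \<ge> 1"
  shows "f x - fourier_partial_sum (n - 1) f x =
        1 / pi * integral\<^sup>L circle (\<lambda>u. \<phi> u * kernel_tail r (\<beta> * pi / 2) n (x - u))"
proof -
  define \<theta> where "\<theta> = \<beta> * pi / 2"
  from \<phi>L have per: "periodic_fun_simple \<phi> (2 * pi)" and \<phi>: "integrable circle \<phi>"
    by (auto simp: L1_periodic_iff)
  define g where "g = kernel_harmonic r \<theta> \<phi>"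
  have g_sums: "(\<lambda>k. g (m + k) x) sums
      (1 / pi * integral\<^sup>L circle (\<lambda>u. \<phi> u * kernel_tail r \<theta> m (x - u)))" for m x
    unfolding g_def by (rule kernel_harmonic_sums[OF r \<phi>])
  have "(LINT t:{-pi..pi}|lebesgue. \<phi> (x - t) * weyl_nagy_kernel r \<beta> t) =
      integral\<^sup>L circle (\<lambda>u. \<phi> u * kernel_tail r \<theta> 1 (x - u))" for x
  proof -
    have "integrable circle (\<lambda>u. \<phi> u * kernel_tail r \<theta> 1 (x - u))"
      by (rule circle_integrable_mult[OF \<phi> measurable_reflect_continuous[OF kernel_tail_continuous[OF r]]
          kernel_tail_bound[OF r]])
    from circle_reflect(2)[OF periodic_mult[OF per periodic_reflect[OF kernel_tail_periodic]] this, of x]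
    show ?thesis by (simp add: set_integral_circle weyl_nagy_kernel_eq_tail \<theta>_def)
  qed
  hence f_sums: "(\<lambda>k. g (Suc k) x) sums (f x - a0 / 2)" for x
    using g_sums[of 1 x] by (simp add: feq)
  \<comment> \<open>Integrability of f is not part of its description. It is obtained from
    continuity and boundedness, both read off from this series by the Weierstrass test.\<close>
  have f_eq: "f = (\<lambda>x. a0 / 2 + (\<Sum>k. g (Suc k) x))"
  proof
    fix x show "f x = a0 / 2 + (\<Sum>k. g (Suc k) x)"
      using sums_unique[OF f_sums[of x]] by linarith
  qed
  define N where "N = integral\<^sup>L circle (\<lambda>t. \<bar>\<phi> t\<bar>)"
  have g_bound: "\<bar>g k x\<bar> \<le> real k powr (-r) * (N / pi)" for k x
    using kernel_harmonic_bound[OF \<phi>, of r \<theta> k x] by (simp add: g_def N_def)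
  have summ: "summable (\<lambda>k. real (Suc k) powr (-r) * (N / pi))"
    using summable_powr_shift[OF r, of 1] by (intro summable_mult2) simp
  have g_cont: "continuous_on UNIV (\<lambda>x. g k x)" for k
  proof -
    obtain b where b: "\<And>t. g k (0 - t) = g k 0 * cos (real k * t) + b * sin (real k * t)"
      using kernel_harmonic_translate[OF \<phi>] unfolding g_def by blast
    have eq: "g k t = g k 0 * cos (real k * (- t)) + b * sin (real k * (- t))" for t
      using b[of "- t"] by simp
    have "continuous_on UNIV (\<lambda>t. g k 0 * cos (real k * (- t)) + b * sin (real k * (- t)))"
      by (intro continuous_intros)
    thus ?thesis unfolding eq[symmetric] .
  qed
  have "uniform_limit UNIV (\<lambda>M x. \<Sum>k<M. g (Suc k) x) (\<lambda>x. \<Sum>k. g (Suc k) x) sequentially"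
    by (rule Weierstrass_m_test[OF _ summ], unfold real_norm_def, rule g_bound)
  hence f_cont: "continuous_on UNIV f"
    unfolding f_eq
    by (intro continuous_on_add continuous_on_const uniform_limit_theorem[rotated])
       (auto intro!: always_eventually continuous_on_sum g_cont)
  have f_bound: "\<bar>f x\<bar> \<le> \<bar>a0 / 2\<bar> + (\<Sum>k. real (Suc k) powr (-r) * (N / pi))" for x
  proof -
    have "\<bar>\<Sum>k. g (Suc k) x\<bar> \<le> (\<Sum>k. real (Suc k) powr (-r) * (N / pi))"
      by (rule norm_suminf_le[OF _ summ, of "\<lambda>k. g (Suc k) x", unfolded real_norm_def, OF g_bound])
    thus ?thesis unfolding f_eq by linarith
  qed
  have f_int: "integrable circle f"
    by (rule circle_integrable_bounded[OF circle_continuous_measurable[OF f_cont] f_bound])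
  have coeff: "integral\<^sup>L circle (\<lambda>t. f (x - t) * cos (real j * t)) = (if j = 0 then pi * a0 else pi * g j x)"
    for j x
  proof -
    define G where "G k t = g (Suc k) (x - t) * cos (real j * t)" for k t
    have G_int: "integrable circle (G k)"
      and G_val: "integral\<^sup>L circle (G k) = (if j = Suc k then pi * g j x else 0)" for k
      using kernel_harmonic_coefficient[OF \<phi>, of "Suc k" r \<theta> x j]
      unfolding G_def[abs_def] g_def by auto
    have G_bound: "norm (G k t) \<le> real (Suc k) powr (-r) * (N / pi)" for k t
    proof -
      have "norm (G k t) \<le> \<bar>g (Suc k) (x - t)\<bar>"
        by (simp add: G_def abs_mult mult_left_le)
      with g_bound[of "Suc k" "x - t"] show ?thesis by linarith
    qed
    have "(\<lambda>k. integral\<^sup>L circle (G k)) sums integral\<^sup>L circle (\<lambda>t. \<Sum>k. G k t)"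
    proof (rule sums_integral[OF G_int])
      show "AE t in circle. summable (\<lambda>k. norm (G k t))"
        by (intro AE_I2 summable_comparison_test'[OF summ]) (use G_bound in auto)
      have "integral\<^sup>L circle (\<lambda>t. norm (G k t)) \<le> real (Suc k) powr (-r) * (N / pi) * (2 * pi)" for k
      proof -
        have "integral\<^sup>L circle (\<lambda>t. norm (G k t)) \<le> integral\<^sup>L circle (\<lambda>t. real (Suc k) powr (-r) * (N / pi))"
          by (intro integral_mono integrable_norm G_int G_bound circle_integrable_bounded[OF _ order_refl]) simp
        thus ?thesis by simp
      qed
      thus "summable (\<lambda>k. integral\<^sup>L circle (\<lambda>t. norm (G k t)))"
        by (intro summable_comparison_test'[OF summable_mult2[OF summ, of "2 * pi"]]) simp
    qed
    moreover have "(\<Sum>k. G k t) = (f (x - t) - a0 / 2) * cos (real j * t)" for t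
      using sums_unique[OF sums_mult2[OF f_sums[of "x - t"]]] by (simp add: G_def)
    ultimately have s: "(\<lambda>k. integral\<^sup>L circle (G k)) sums
        integral\<^sup>L circle (\<lambda>t. (f (x - t) - a0 / 2) * cos (real j * t))"
      by simp
    \<comment> \<open>\<open>G k\<close> carries the frequency Suc k, so only k = j - 1 contributes,
      and nothing does for j = 0.\<close>
    have s': "(\<lambda>k. integral\<^sup>L circle (G k)) sums (if j = 0 then 0 else pi * g j x)"
    proof (cases j)
      case (Suc i)
      have "integral\<^sup>L circle (G k) = (if k = i then pi * g j x else 0)" for k
        unfolding G_val using Suc by auto
      with sums_single[of i "\<lambda>k. pi * g j x"] Suc show ?thesis by simp
    qed (simp add: G_val)
    have "integral\<^sup>L circle (\<lambda>t. (f (x - t) - a0 / 2) * cos (real j * t)) = (if j = 0 then 0 else pi * g j x)"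
      using sums_unique2[OF s s'] .
    moreover have "integral\<^sup>L circle (\<lambda>t. (f (x - t) - a0 / 2) * cos (real j * t)) =
        integral\<^sup>L circle (\<lambda>t. f (x - t) * cos (real j * t)) - a0 / 2 * integral\<^sup>L circle (\<lambda>t. cos (real j * t))"
    proof -
      have "integrable circle (\<lambda>t. f (x - t) * cos (real j * t))"
        by (rule circle_integrable_mult[OF circle_reflect(1)[OF perf f_int], where K = 1])
           (auto intro!: circle_continuous_measurable continuous_intros)
      thus ?thesis by (simp add: left_diff_distrib)
    qed
    ultimately show ?thesis
      using integral_circle_cos_int[of "int j"] by (auto split: if_splits)
  qed
  have term_eq: "fourier_cos_coeff f j * cos (real j * x) + fourier_sin_coeff f j * sin (real j * x) = g j x"
    if "j \<ge> 1" for j x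
    using coeff[of x j] that by (subst fourier_term_convolution[OF perf f_int]) auto
  have zero_eq: "fourier_cos_coeff f 0 = a0"
    using fourier_term_convolution[OF perf f_int, of 0 0] coeff[of 0 0] by simp
  have S: "fourier_partial_sum (n - 1) f x = a0 / 2 + (\<Sum>k<n-1. g (Suc k) x)"
  proof -
    have "(\<Sum>k=1..n-1. g k x) = (\<Sum>k<n-1. g (Suc k) x)"
      by (rule sum.reindex_bij_witness[of _ Suc "\<lambda>k. k - 1"]) auto
    thus ?thesis by (simp add: fourier_partial_sum_def zero_eq term_eq)
  qed
  have "(\<lambda>k. g (Suc (k + (n - 1))) x) sums (f x - a0 / 2 - (\<Sum>k<n-1. g (Suc k) x))"
    using sums_split_initial_segment[OF f_sums[of x], of "n - 1"] by simp
  moreover have "Suc (k + (n - 1)) = n + k" for k using n by simp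
  ultimately have "(\<lambda>k. g (n + k) x) sums (f x - a0 / 2 - (\<Sum>k<n-1. g (Suc k) x))"
    by (simp add: add.commute[of n])
  from sums_unique2[OF this g_sums] show ?thesis unfolding S \<theta>_def by linarith
qed

section \<open>Test functions and the exact value of the supremum\<close>

lemma weyl_nagy_class_memI:
  assumes "\<phi> \<in> L1_periodic" "L1_norm \<phi> \<le> 1" "integral\<^sup>L circle \<phi> = 0"
  shows "(\<lambda>x. 1 / pi * (LINT t:{-pi..pi}|lebesgue. \<phi> (x - t) * weyl_nagy_kernel r \<beta> t))
           \<in> weyl_nagy_class r \<beta>" (is "?f \<in> _")
proof -
  have per: "periodic_fun_simple \<phi> (2 * pi)" using assms(1) by (simp add: L1_periodic_iff)
  have "periodic_fun_simple ?f (2 * pi)"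
  proof
    fix x
    have "\<phi> (x + 2 * pi - t) = \<phi> (x - t)" for t
      using periodic_simple_plus_int[OF per, of "x - t" 1] by (simp add: algebra_simps)
    thus "?f (x + 2 * pi) = ?f x" by simp
  qed
  moreover have "?f x = 0 / 2 + ?f x" for x by simp
  ultimately show ?thesis
    unfolding weyl_nagy_class_def mem_Collect_eq using assms
    by (intro conjI exI[of _ 0] bexI[of _ \<phi>] allI) (auto simp: set_integral_circle)
qed

text \<open>The condition on cosines makes the function periodic by construction; for 0 < h < pi it
  picks out \<bar>u\<bar> < h within one period. The height gives mass 1/2, so that a difference of
  two translates has mean zero and norm at most 1.\<close>

definition arc_kernel :: "real \<Rightarrow> real \<Rightarrow> real" where
  "arc_kernel h u = (if cos u > cos h then 1 / (4 * h) else 0)"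

lemma arc_kernel_periodic: "periodic_fun_simple (arc_kernel h) (2 * pi)"
  by standard (simp add: arc_kernel_def)

lemma arc_kernel_nonneg: "h > 0 \<Longrightarrow> 0 \<le> arc_kernel h u"
  by (simp add: arc_kernel_def)

lemma arc_kernel_circle:
  assumes "0 < h" "h < pi" "u \<in> {-pi..pi}"
  shows "arc_kernel h u = indicator {-h<..<h} u / (4 * h)"
proof -
  have "cos u > cos h \<longleftrightarrow> \<bar>u\<bar> < h"
    using cos_mono_less_eq[of h "\<bar>u\<bar>"] assms by auto
  thus ?thesis by (auto simp: arc_kernel_def indicator_def)
qed

lemma arc_kernel_integral:
  assumes "0 < h" "h < pi"
  shows "integrable circle (arc_kernel h)" "integral\<^sup>L circle (arc_kernel h) = 1 / 2"
proof -
  have m: "arc_kernel h \<in> borel_measurable circle"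
  proof -
    have "arc_kernel h \<in> borel_measurable borel"
      unfolding arc_kernel_def[abs_def] by measurable
    thus ?thesis
      by (metis borel_measurable_continuous_onI measurable_completion measurable_lborel2 measurable_restrict_space1)
  qed
  show i: "integrable circle (arc_kernel h)"
    by (rule circle_integrable_bounded[OF m, where K = "1 / (4 * h)"])
       (use assms in \<open>auto simp: arc_kernel_def\<close>)
  have "integral\<^sup>L circle (arc_kernel h) = integral\<^sup>L circle (\<lambda>u. indicator {-h<..<h} u / (4 * h))"
    using arc_kernel_circle[OF assms] by (intro Bochner_Integration.integral_cong) auto
  also have "\<dots> = measure circle {-h<..<h} / (4 * h)"
  proof -
    have "{-h<..<h} \<inter> {-pi..pi} = {-h<..<h}" using assms by auto
    thus ?thesis by simp
  qed
  also have "measure circle {-h<..<h} = 2 * h"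
    using assms by (subst measure_restrict_space) auto
  finally show "integral\<^sup>L circle (arc_kernel h) = 1 / 2" using assms by simp
qed

lemma arc_kernel_approx:
  assumes h: "0 < h" "h < pi" and G: "continuous_on UNIV G" "\<And>u. \<bar>G u\<bar> \<le> K"
    and near: "\<And>u. \<bar>u\<bar> < h \<Longrightarrow> G u \<ge> a"
  shows "a / 2 \<le> integral\<^sup>L circle (\<lambda>u. arc_kernel h u * G u)"
proof -
  note K = arc_kernel_integral[OF h]
  have "integral\<^sup>L circle (\<lambda>u. arc_kernel h u * a) \<le> integral\<^sup>L circle (\<lambda>u. arc_kernel h u * G u)"
  proof (rule integral_mono)
    fix u assume "u \<in> space circle"
    hence "u \<in> {-pi..pi}" by simp
    from arc_kernel_circle[OF h this] near[of u] h
    show "arc_kernel h u * a \<le> arc_kernel h u * G u"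
      by (auto simp: indicator_def abs_less_iff divide_right_mono)
  qed (auto intro!: K circle_integrable_mult[OF K(1) circle_continuous_measurable[OF G(1)] G(2)])
  thus ?thesis by (simp add: K)
qed

text \<open>Mean zero allows T to be replaced by T - c in the convolution, and the midpoint c of the
  range gives the smallest uniform norm, half the oscillation. Conversely, mass 1/2 near x - s and
  mass -1/2 near x - t make the convolution at x approximate (T s - T t) / 2. The test function may
  depend on x, hence the same value for every x.\<close>

lemma fourier_sup_deviation_weyl_nagy:
  fixes r \<beta> :: real and n :: nat
  defines "T \<equiv> kernel_tail r (\<beta> * pi / 2) n"
  assumes r: "r > 1" and n: "n \<ge> 1"
  shows "fourier_sup_deviation n (weyl_nagy_class r \<beta>) x =
           ereal ((Sup (range T) - Inf (range T)) / (2 * pi))"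
proof (rule antisym)
  define M m where "M = Sup (range T)" and "m = Inf (range T)"
  obtain K where K: "\<And>t. \<bar>T t\<bar> \<le> K"
    using kernel_tail_bound[OF r] unfolding T_def by blast
  have cont: "continuous_on UNIV T" and perT: "periodic_fun_simple T (2 * pi)"
    unfolding T_def by (rule kernel_tail_continuous[OF r] kernel_tail_periodic)+
  have bdd: "bdd_above (range T)" "bdd_below (range T)"
    using K by (auto intro!: bdd_aboveI[of _ K] bdd_belowI[of _ "-K"] simp: abs_le_iff minus_le_iff)
  have le: "T t \<le> M" "m \<le> T t" for t
    using bdd by (auto simp: M_def m_def intro!: cSup_upper cInf_lower)
  show "fourier_sup_deviation n (weyl_nagy_class r \<beta>) x \<le>
      ereal ((Sup (range T) - Inf (range T)) / (2 * pi))"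
    unfolding fourier_sup_deviation_def M_def[symmetric] m_def[symmetric]
  proof (rule SUP_least)
    fix f assume "f \<in> weyl_nagy_class r \<beta>"
    then obtain a0 \<phi> where perf: "periodic_fun_simple f (2 * pi)" and \<phi>L: "\<phi> \<in> L1_periodic"
      and norm: "L1_norm \<phi> \<le> 1" and zero: "(LINT t:{-pi..pi}|lebesgue. \<phi> t) = 0"
      and feq: "\<And>x. f x = a0 / 2 +
         1 / pi * (LINT t:{-pi..pi}|lebesgue. \<phi> (x - t) * weyl_nagy_kernel r \<beta> t)"
      unfolding weyl_nagy_class_def by blast
    have \<phi>: "integrable circle \<phi>" using \<phi>L by (simp add: L1_periodic_iff)
    define c where "c = (M + m) / 2"
    have dev: "\<bar>T y - c\<bar> \<le> (M - m) / 2" for y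
      using le[of y] unfolding c_def abs_le_iff by (auto simp: field_simps)
    have int: "integrable circle (\<lambda>u. \<phi> u * T (x - u))"
      by (rule circle_integrable_mult[OF \<phi> measurable_reflect_continuous[OF cont] K])
    have "integral\<^sup>L circle (\<lambda>u. \<phi> u * T (x - u)) = integral\<^sup>L circle (\<lambda>u. \<phi> u * (T (x - u) - c))"
      using int \<phi> zero by (simp add: right_diff_distrib set_integral_circle)
    also have "\<bar>\<dots>\<bar> \<le> integral\<^sup>L circle (\<lambda>u. \<bar>\<phi> u\<bar> * ((M - m) / 2))"
    proof (rule order_trans[OF integral_abs_bound], rule integral_mono)
      show "integrable circle (\<lambda>u. \<bar>\<phi> u * (T (x - u) - c)\<bar>)"
        using int \<phi> by (simp add: right_diff_distrib)
      show "\<bar>\<phi> u * (T (x - u) - c)\<bar> \<le> \<bar>\<phi> u\<bar> * ((M - m) / 2)" for u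
        unfolding abs_mult by (intro mult_left_mono dev) auto
    qed (use \<phi> in auto)
    also have "\<dots> = L1_norm \<phi> * ((M - m) / 2)" by (simp add: L1_norm_circle)
    also have "\<dots> \<le> 1 * ((M - m) / 2)"
      using norm le[of 0] by (intro mult_right_mono) auto
    finally have "\<bar>1 / pi * integral\<^sup>L circle (\<lambda>u. \<phi> u * T (x - u))\<bar> \<le> (M - m) / (2 * pi)"
      by (simp add: abs_mult field_simps)
    thus "ereal \<bar>f x - fourier_partial_sum (n - 1) f x\<bar> \<le> ereal ((M - m) / (2 * pi))"
      using weyl_nagy_remainder[OF perf \<phi>L feq r n, of x] by (simp add: T_def)
  qed
  show "ereal ((Sup (range T) - Inf (range T)) / (2 * pi)) \<le>
      fourier_sup_deviation n (weyl_nagy_class r \<beta>) x"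
    unfolding M_def[symmetric] m_def[symmetric]
  proof (rule ereal_le_epsilon2)
    fix e :: real assume e: "e > 0"
    obtain s where s: "T s > M - e"
      using less_cSup_iff[of "range T" "M - e"] bdd e by (auto simp: M_def)
    obtain t where t: "T t < m + e"
      using cInf_less_iff[of "range T" "m + e"] bdd e by (auto simp: m_def)
    define G where "G u = T (s - u) - T (t - u)" for u
    have contG: "continuous_on UNIV G"
      unfolding G_def
      by (intro continuous_on_diff continuous_on_compose2[OF cont] continuous_intros) auto
    have "G 0 > M - m - 2 * e" using s t by (simp add: G_def)
    moreover have "(G \<longlongrightarrow> G 0) (at 0)"
      using contG by (simp add: continuous_on_def)
    ultimately have "eventually (\<lambda>u. G u > M - m - 2 * e) (at 0)"
      by (rule order_tendstoD(1)[rotated])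
    then obtain d where d: "d > 0" "\<And>u. u \<noteq> 0 \<Longrightarrow> \<bar>u\<bar> < d \<Longrightarrow> G u > M - m - 2 * e"
      unfolding eventually_at by (auto simp: dist_real_def)
    define h where "h = min d 1"
    have h: "0 < h" "h < pi" using d(1) pi_gt3 by (auto simp: h_def)
    have near: "G u \<ge> M - m - 2 * e" if "\<bar>u\<bar> < h" for u
      using d(2)[of u] that \<open>G 0 > _\<close> by (cases "u = 0") (auto simp: h_def)
    have "\<bar>G u\<bar> \<le> 2 * K" for u
      using K[of "s - u"] K[of "t - u"] unfolding G_def by linarith
    from arc_kernel_approx[OF h contG this near]
    have lower: "(M - m - 2 * e) / 2 \<le> integral\<^sup>L circle (\<lambda>u. arc_kernel h u * G u)" by simp
    define \<phi> where "\<phi> u = arc_kernel h (u - (x - s)) - arc_kernel h (u - (x - t))" for u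
    have shift: "integrable circle (\<lambda>u. arc_kernel h (u - c))"
      "integral\<^sup>L circle (\<lambda>u. arc_kernel h (u - c)) = 1 / 2" for c
      using circle_shift[OF arc_kernel_periodic arc_kernel_integral(1)[OF h], of "-c"]
        arc_kernel_integral[OF h] by auto
    have \<phi>: "integrable circle \<phi>" unfolding \<phi>_def using shift by simp
    have "periodic_fun_simple \<phi> (2 * pi)"
    proof
      fix u show "\<phi> (u + 2 * pi) = \<phi> u"
        using periodic_simple_plus_int[OF arc_kernel_periodic, of h _ 1]
        by (simp add: \<phi>_def diff_add_eq[symmetric])
    qed
    with \<phi> have \<phi>L: "\<phi> \<in> L1_periodic" by (simp add: L1_periodic_iff)
    have zero: "integral\<^sup>L circle \<phi> = 0"
      unfolding \<phi>_def using shift(1) by (simp add: shift(2))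
    have "L1_norm \<phi> \<le> integral\<^sup>L circle (\<lambda>u. arc_kernel h (u - (x - s)) + arc_kernel h (u - (x - t)))"
      unfolding L1_norm_circle
    proof (rule integral_mono)
      fix u
      show "\<bar>\<phi> u\<bar> \<le> arc_kernel h (u - (x - s)) + arc_kernel h (u - (x - t))"
        using arc_kernel_nonneg[OF h(1), of "u - (x - s)"] arc_kernel_nonneg[OF h(1), of "u - (x - t)"]
        unfolding \<phi>_def by linarith
    qed (use \<phi> shift in auto)
    hence norm: "L1_norm \<phi> \<le> 1" using shift by simp
    have conv: "integrable circle (\<lambda>u. arc_kernel h (u - (x - y)) * T (x - u))"
      "integrable circle (\<lambda>u. arc_kernel h u * T (y - u))"
      "integral\<^sup>L circle (\<lambda>u. arc_kernel h (u - (x - y)) * T (x - u)) =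
         integral\<^sup>L circle (\<lambda>u. arc_kernel h u * T (y - u))" for y
    proof -
      show *: "integrable circle (\<lambda>u. arc_kernel h u * T (y - u))"
        by (rule circle_integrable_mult[OF arc_kernel_integral(1)[OF h] measurable_reflect_continuous[OF cont] K])
      show "integrable circle (\<lambda>u. arc_kernel h (u - (x - y)) * T (x - u))"
        by (rule circle_integrable_mult[OF shift(1) measurable_reflect_continuous[OF cont] K])
      have "periodic_fun_simple (\<lambda>u. arc_kernel h u * T (y - u)) (2 * pi)"
        by (intro periodic_mult arc_kernel_periodic periodic_reflect perT)
      from circle_shift(2)[OF this *, of "- (x - y)"]
      show "integral\<^sup>L circle (\<lambda>u. arc_kernel h (u - (x - y)) * T (x - u)) =
         integral\<^sup>L circle (\<lambda>u. arc_kernel h u * T (y - u))"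
        by (simp add: algebra_simps)
    qed
    have "integral\<^sup>L circle (\<lambda>u. \<phi> u * T (x - u)) = integral\<^sup>L circle (\<lambda>u. arc_kernel h u * G u)"
      unfolding \<phi>_def G_def left_diff_distrib right_diff_distrib using conv by simp
    with lower have "(M - m - 2 * e) / 2 \<le> integral\<^sup>L circle (\<lambda>u. \<phi> u * T (x - u))"
      by simp
    from divide_right_mono[OF this, of pi]
    have "(M - m - 2 * e) / 2 / pi \<le> 1 / pi * integral\<^sup>L circle (\<lambda>u. \<phi> u * T (x - u))"
      by simp
    also define f where "f x = 1 / pi * (LINT t:{-pi..pi}|lebesgue. \<phi> (x - t) * weyl_nagy_kernel r \<beta> t)" for x
    have fW: "f \<in> weyl_nagy_class r \<beta>"
      unfolding f_def by (rule weyl_nagy_class_memI[OF \<phi>L norm zero])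
    have "1 / pi * integral\<^sup>L circle (\<lambda>u. \<phi> u * T (x - u)) = f x - fourier_partial_sum (n - 1) f x"
      using weyl_nagy_remainder[OF _ \<phi>L, of f 0 r \<beta> n x] fW r n
      by (simp add: T_def f_def weyl_nagy_class_def)
    also have "\<dots> \<le> \<bar>f x - fourier_partial_sum (n - 1) f x\<bar>" by simp
    also have "(M - m - 2 * e) / 2 / pi = (M - m) / (2 * pi) - e / pi"
      by (simp add: field_simps)
    finally have "(M - m) / (2 * pi) - e / pi \<le> \<bar>f x - fourier_partial_sum (n - 1) f x\<bar>" .
    moreover have "e / pi \<le> e" using e pi_gt3 by (simp add: field_simps)
    ultimately have "ereal ((M - m) / (2 * pi)) \<le> ereal \<bar>f x - fourier_partial_sum (n - 1) f x\<bar> + ereal e"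
      by simp
    also have "\<dots> \<le> fourier_sup_deviation n (weyl_nagy_class r \<beta>) x + ereal e"
      unfolding fourier_sup_deviation_def by (intro add_right_mono SUP_upper fW)
    finally show "ereal ((M - m) / (2 * pi)) \<le> fourier_sup_deviation n (weyl_nagy_class r \<beta>) x + ereal e" .
  qed
qed

section \<open>Estimates of the dilated series\<close>

text \<open>Mean value theorem: the derivative p * z powr (p - 1) is at least p for z > 1. A real
  exponent is allowed because \<open>dilated_powr_decay\<close> applies this to a quotient e /
  p.\<close>

lemma bernoulli_powr:
  fixes y p :: real
  assumes "y \<ge> 0" "p \<ge> 1"
  shows "1 + p * y \<le> (1 + y) powr p"
proof (cases "y = 0")
  case False
  have "\<exists>z>1. z < 1 + y \<and> (1 + y) powr p - 1 powr p = (1 + y - 1) * (p * z powr (p - 1))"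
    using assms False by (intro MVT2) (auto intro!: derivative_eq_intros)
  then obtain z where z: "z > 1" "(1 + y) powr p - 1 = y * (p * z powr (p - 1))"
    by auto
  have "1 \<le> z powr (p - 1)"
    using z(1) assms by (intro ge_one_powr_ge_zero) auto
  hence "y * (p * 1) \<le> y * (p * z powr (p - 1))"
    using assms by (intro mult_left_mono) auto
  thus ?thesis using z(2) by (simp add: mult.commute)
qed simp

lemma summable_dilated_powr:
  assumes "r > 1" "n \<ge> 1"
  shows "summable (\<lambda>k. (1 + real k / real n) powr (-r))"
proof -
  have "summable (\<lambda>k. real k powr (-r))"
    using assms by (simp add: summable_real_powr_iff)
  from summable_mult[OF summable_ignore_initial_segment[OF this, of n], of "real n powr r"]
  show ?thesis
  proof (rule back_subst[of summable], intro ext)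
    fix k
    have "1 + real k / real n = real (k + n) / real n" using assms by (simp add: field_simps)
    thus "real n powr r * real (k + n) powr (-r) = (1 + real k / real n) powr (-r)"
      by (simp add: powr_divide powr_minus field_simps)
  qed
qed

text \<open>With \<open>x = k / n\<close> the weight is \<open>x\<^sup>2 / (1 + x)\<close> times \<open>(1 + x) powr (-r)\<close>. The factor is of order
  \<open>min x (x\<^sup>2)\<close>; the plain Taylor bound \<open>x\<^sup>2\<close> would give a divergent series for \<open>r \<le> 3\<close>.\<close>

definition dilated_weight :: "real \<Rightarrow> nat \<Rightarrow> nat \<Rightarrow> real" where
  "dilated_weight r n k = (real k / real n)\<^sup>2 * (1 + real k / real n) powr (-(r + 1))"

lemma dilated_weight_nonneg: "dilated_weight r n k \<ge> 0"
  by (simp add: dilated_weight_def)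

lemma dilated_weight_eq:
  "dilated_weight r n k = (real k / real n)\<^sup>2 / (1 + real k / real n) * (1 + real k / real n) powr (-r)"
proof -
  have "1 + real k / real n > 0" by (simp add: add_pos_nonneg)
  hence "(1 + real k / real n) powr (-(r + 1)) = (1 + real k / real n) powr (-r) / (1 + real k / real n)"
    using powr_diff[of "1 + real k / real n" "-r" 1] by simp
  thus ?thesis by (simp add: dilated_weight_def)
qed

text \<open>With x = k / n, the bound x^2 <= (1 + x)^2 leaves (1 + x) powr (-(r - 1)), whose
  exponent exceeds 1 in size precisely for r > 2.\<close>

lemma summable_dilated_weight:
  assumes "r > 2" "n \<ge> 1"
  shows "summable (dilated_weight r n)"
proof (rule summable_comparison_test'[OF summable_dilated_powr[of "r - 1" n]])
  fix k
  define y where "y = 1 + real k / real n"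
  have y: "y \<ge> 1" by (simp add: y_def)
  have "dilated_weight r n k = (y - 1)\<^sup>2 * y powr (-(r + 1))" by (simp add: dilated_weight_def y_def)
  also have "\<dots> \<le> y\<^sup>2 * y powr (-(r + 1))"
    using y by (intro mult_right_mono power_mono) auto
  also have "\<dots> = y powr 2 * y powr (-(r + 1))" using y by simp
  also have "\<dots> = y powr (-(r - 1))" by (subst powr_add[symmetric]) (simp add: algebra_simps)
  finally show "norm (dilated_weight r n k) \<le> (1 + real k / real n) powr (-(r - 1))"
    using dilated_weight_nonneg[of r n k] by (simp add: y_def)
qed (use assms in auto)

lemma one_minus_cos_le_square: "1 - cos y \<le> y\<^sup>2 / 2" for y :: real
proof -
  have "1 - cos y = 2 * (sin (y / 2))\<^sup>2"
    using cos_double_sin[of "y / 2"] by simp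
  moreover have "(sin (y / 2))\<^sup>2 \<le> (y / 2)\<^sup>2"
    using abs_sin_x_le_abs_x[of "y / 2"] by (simp only: abs_le_square_iff)
  ultimately show ?thesis by (simp add: power_divide)
qed

text \<open>For x <= 1 the quadratic bound applies and 1 + x <= 2; the constant 10 is a bound for
  pi^2. For x > 1 the trivial bound 2 suffices, because 1 + x <= 2 x^2.\<close>

lemma one_minus_cos_le:
  fixes x y :: real
  assumes "\<bar>y\<bar> \<le> pi * x"
  shows "1 - cos y \<le> 10 * (x\<^sup>2 / (1 + x))"
proof -
  have "0 \<le> pi * x" using assms abs_ge_zero[of y] by linarith
  hence x: "x \<ge> 0" using pi_gt_zero by (metis zero_le_mult_iff not_less)
  show ?thesis
  proof (cases "x \<le> 1")
    case True
    have "pi * pi \<le> 3.15 * 3.15" using pi_approx by (intro mult_mono) auto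
    hence pi: "pi\<^sup>2 \<le> 10" by (simp add: power2_eq_square)
    have "y\<^sup>2 \<le> (pi * x)\<^sup>2" using assms x by (simp add: abs_le_square_iff[symmetric])
    also have "\<dots> \<le> 10 * x\<^sup>2" unfolding power_mult_distrib using pi by (intro mult_right_mono) auto
    finally have "1 - cos y \<le> 10 * (x\<^sup>2 / 2)" using one_minus_cos_le_square[of y] by simp
    also have "\<dots> \<le> 10 * (x\<^sup>2 / (1 + x))"
      using True x by (intro mult_left_mono divide_left_mono) auto
    finally show ?thesis .
  next
    case False
    have "1 * (1 + x) \<le> 2 * x\<^sup>2"
    proof -
      have "0 \<le> (x - 1) * (2 * x + 1)" using False by (intro mult_nonneg_nonneg) auto
      thus ?thesis by (simp add: power2_eq_square algebra_simps)
    qed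
    hence "1 \<le> 2 * (x\<^sup>2 / (1 + x))" using False by (simp add: field_simps)
    thus ?thesis using cos_ge_minus_one[of y] by linarith
  qed
qed

text \<open>With x = k / n the difference equals (1 + x) powr (-r) * (1 - exp (-r (x - ln (1 +
  x)))). Then 1 - exp (-z) <= z, and ln (1 + x) >= x / (1 + x) gives x - ln (1 + x) <= x^2 / (1 +
  x), the weight factor.\<close>

lemma dilated_powr_exp_diff:
  fixes r :: real
  assumes "r > 0"
  shows "exp (- r / n) ^ k \<le> (1 + real k / real n) powr (-r)"
    and "(1 + real k / real n) powr (-r) - exp (- r / n) ^ k \<le> r * dilated_weight r n k"
proof -
  define x where "x = real k / real n"
  have x: "x \<ge> 0" by (simp add: x_def)
  have q: "exp (- r / n) ^ k = exp (- (r * x))"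
    by (simp add: exp_of_nat_mult[symmetric] x_def)
  have a: "(1 + x) powr (-r) = exp (- (r * ln (1 + x)))"
    using x by (simp add: powr_def)
  have "ln (1 + x) \<le> x" using x by (rule ln_add_one_self_le_self)
  thus "exp (- r / n) ^ k \<le> (1 + real k / real n) powr (-r)"
    using assms unfolding q x_def[symmetric] a by simp
  have "ln (1 / (1 + x)) \<le> 1 / (1 + x) - 1" using x by (intro ln_le_minus_one) auto
  hence ln: "x - ln (1 + x) \<le> x\<^sup>2 / (1 + x)"
    using x by (simp add: ln_div field_simps power2_eq_square)
  have "1 + (- (r * (x - ln (1 + x)))) \<le> exp (- (r * (x - ln (1 + x))))"
    by (rule exp_ge_add_one_self)
  hence "(1 + x) powr (-r) * (1 - exp (- (r * (x - ln (1 + x))))) \<le> (1 + x) powr (-r) * (r * (x\<^sup>2 / (1 + x)))"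
    using mult_left_mono[OF ln, of r] assms by (intro mult_left_mono) auto
  moreover have "(1 + x) powr (-r) * exp (- (r * (x - ln (1 + x)))) = exp (- (r * x))"
    unfolding a by (simp add: exp_add[symmetric] algebra_simps)
  ultimately show "(1 + real k / real n) powr (-r) - exp (- r / n) ^ k \<le> r * dilated_weight r n k"
    unfolding q dilated_weight_eq x_def[symmetric] by (simp add: algebra_simps)
qed

text \<open>\<open>H\<close> is an antiderivative of \<open>x\<^sup>2 * (1 + x) powr (-(r + 1))\<close>. Since \<open>r + 1 \<le> n + 2\<close>, this function decreases by
  at most a bounded factor over a step \<open>1 / n\<close>, so each term is bounded by an increment of \<open>H\<close>.\<close>

lemma sum_dilated_weight_small:
  assumes r: "r > 2" and n: "n \<ge> 2" and rn: "r \<le> real n + 1"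
  shows "suminf (dilated_weight r n) \<le> 2 * exp 2 * real n / (r * (r - 1) * (r - 2))"
proof (rule suminf_le_const)
  show "summable (dilated_weight r n)" using summable_dilated_weight[OF r] n by simp
next
  fix N
  define H where "H x = - ((1 + x) powr (2 - r) / (r - 2) - 2 * (1 + x) powr (1 - r) / (r - 1) +
      (1 + x) powr (-r) / r)" for x :: real
  have deriv: "(H has_real_derivative x\<^sup>2 * (1 + x) powr (-(r + 1))) (at x)" if x: "x \<ge> 0" for x
  proof -
    have p: "(1 + x) powr (1 - r) = (1 + x)\<^sup>2 * (1 + x) powr (-(r + 1))"
      "(1 + x) powr (- r) = (1 + x) * (1 + x) powr (-(r + 1))"
      using x powr_add[of "1 + x" 2 "-(r + 1)"] powr_add[of "1 + x" 1 "-(r + 1)"] by simp_all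
    have P: "((\<lambda>x. (1 + x) powr q) has_real_derivative q * (1 + x) powr (q - 1)) (at x)" for q
      using x by (auto intro!: derivative_eq_intros)
    have e: "2 - r - 1 = 1 - r" "1 - r - 1 = - r" "- r - 1 = - (r + 1)" by simp_all
    have "(H has_real_derivative
        - ((2 - r) * (1 + x) powr (1 - r) / (r - 2) - 2 * ((1 - r) * (1 + x) powr (- r)) / (r - 1) +
           (- r) * (1 + x) powr (-(r + 1)) / r)) (at x)"
      unfolding H_def
      by (rule DERIV_minus DERIV_add DERIV_diff DERIV_cdivide DERIV_cmult
            P[of "2 - r", unfolded e] P[of "1 - r", unfolded e] P[of "- r", unfolded e])+
    also have "(2 - r) * (1 + x) powr (1 - r) / (r - 2) = - ((1 + x) powr (1 - r))"
      using r by (simp add: field_simps)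
    also have "2 * ((1 - r) * (1 + x) powr (- r)) / (r - 1) = - 2 * (1 + x) powr (- r)"
      using r by (simp add: field_simps)
    also have "(- r) * (1 + x) powr (-(r + 1)) / r = - ((1 + x) powr (-(r + 1)))"
      using r by simp
    finally show ?thesis
      unfolding p by (simp add: power2_eq_square algebra_simps)
  qed
  \<comment> \<open>Completing the square in 1 + x leaves the constant 1 / r - (r - 2) / (r - 1)^2 =
    1 / (r (r - 1)^2), which is positive.\<close>
  have H_le: "H x \<le> 0" if x: "x \<ge> 0" for x
  proof -
    have p: "(1 + x) powr (2 - r) = (1 + x)\<^sup>2 * (1 + x) powr (- r)"
      "(1 + x) powr (1 - r) = (1 + x) * (1 + x) powr (- r)"
      using x powr_add[of "1 + x" 2 "- r"] powr_add[of "1 + x" 1 "- r"] by simp_all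
    have "H x = - ((1 + x) powr (- r) * ((1 + x)\<^sup>2 / (r - 2) - 2 * (1 + x) / (r - 1) + 1 / r))"
      unfolding H_def p by (simp add: algebra_simps)
    moreover have "0 \<le> (1 + x)\<^sup>2 / (r - 2) - 2 * (1 + x) / (r - 1) + 1 / r"
    proof -
      have "(1 + x)\<^sup>2 / (r - 2) - 2 * (1 + x) / (r - 1) + 1 / r =
          (1 + x - (r - 2) / (r - 1))\<^sup>2 / (r - 2) + 1 / (r * (r - 1)\<^sup>2)"
      proof -
        have "y\<^sup>2 / (r - 2) - 2 * y / (r - 1) + 1 / r = (y - (r - 2) / (r - 1))\<^sup>2 / (r - 2) + 1 / (r * (r - 1)\<^sup>2)"
          for y using r by (simp add: divide_simps) (simp add: power2_eq_square algebra_simps)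
        thus ?thesis .
      qed
      thus ?thesis using r by simp
    qed
    ultimately show ?thesis by simp
  qed
  have step: "dilated_weight r n k \<le> exp 2 * real n * (H (real (Suc k) / n) - H (real k / n))" for k
  proof -
    define x where "x = real k / real n"
    have x: "x \<ge> 0" by (simp add: x_def)
    have x': "real (Suc k) / n = x + 1 / n" by (simp add: x_def add_divide_distrib)
    have "\<exists>z>x. z < x + 1 / n \<and> H (x + 1 / n) - H x = (x + 1 / n - x) * (z\<^sup>2 * (1 + z) powr (-(r + 1)))"
      using n x by (intro MVT2 deriv) auto
    then obtain z where z: "z > x" "z < x + 1 / n"
      "H (x + 1 / n) - H x = 1 / n * (z\<^sup>2 * (1 + z) powr (-(r + 1)))" by auto
    have n_eq: "real n * (H (x + 1 / n) - H x) = z\<^sup>2 * (1 + z) powr (-(r + 1))"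
      using z(3) n by simp
    \<comment> \<open>The intermediate point z exceeds x by less than 1 / n <= (1 + x) / n. Passing
      from x to z thus costs the decreasing power at most a factor exp ((r + 1) / n), while the
      factor x^2 only grows.\<close>
    have "1 + z \<le> (1 + x) * (1 + 1 / n)"
    proof -
      have "1 / n \<le> (1 + x) / n" using x by (intro divide_right_mono) auto
      thus ?thesis using z(2) by (simp add: algebra_simps)
    qed
    also have "\<dots> \<le> (1 + x) * exp (1 / n)" using x by (intro mult_left_mono exp_ge_add_one_self) auto
    finally have "((1 + x) * exp (1 / n)) powr (-(r + 1)) \<le> (1 + z) powr (-(r + 1))"
      using z x r by (intro powr_mono2') auto
    also have "((1 + x) * exp (1 / n)) powr (-(r + 1)) = (1 + x) powr (-(r + 1)) * exp (- ((r + 1) / n))"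
    proof -
      have "1 / n * (-(r + 1)) = - ((r + 1) / n)" by (simp add: diff_divide_distrib add_divide_distrib)
      thus ?thesis unfolding powr_mult exp_powr_real by simp
    qed
    finally have 1: "(1 + x) powr (-(r + 1)) * exp (- ((r + 1) / n)) \<le> (1 + z) powr (-(r + 1))" .
    \<comment> \<open>Here r + 1 <= n + 2 <= 2 n is used; this is the source of exp 2.\<close>
    have "(r + 1) / n \<le> 2" using rn n by (simp add: divide_le_eq)
    hence "(1 + x) powr (-(r + 1)) * exp (- 2) \<le> (1 + x) powr (-(r + 1)) * exp (- ((r + 1) / n))"
      by (intro mult_left_mono) auto
    with 1 have "(1 + x) powr (-(r + 1)) * exp (- 2) \<le> (1 + z) powr (-(r + 1))" by linarith
    hence "(1 + x) powr (-(r + 1)) \<le> exp 2 * (1 + z) powr (-(r + 1))"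
      by (simp add: exp_minus field_simps)
    hence "x\<^sup>2 * (1 + x) powr (-(r + 1)) \<le> z\<^sup>2 * (exp 2 * (1 + z) powr (-(r + 1)))"
      using x z by (intro mult_mono power_mono) auto
    also have "\<dots> = exp 2 * (real n * (H (x + 1 / n) - H x))" unfolding n_eq by simp
    finally show ?thesis unfolding x' by (simp add: dilated_weight_def x_def mult.assoc)
  qed
  have "(\<Sum>k<N. dilated_weight r n k) \<le> (\<Sum>k<N. exp 2 * real n * (H (real (Suc k) / n) - H (real k / n)))"
    by (intro sum_mono step)
  also have "\<dots> = exp 2 * real n * (H (real N / n) - H (real 0 / n))"
    by (subst sum_distrib_left[symmetric], subst sum_lessThan_telescope) simp
  also have "\<dots> \<le> exp 2 * real n * (0 - H 0)"
    using H_le[of "real N / n"] by (intro mult_left_mono) auto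
  \<comment> \<open>This is the Beta integral B(3, r - 2) of x^2 (1 + x) powr (-(r + 1)) over the
    half line.\<close>
  also have "0 - H 0 = 2 / (r * (r - 1) * (r - 2))"
    using r by (simp add: H_def divide_simps) (simp add: algebra_simps)
  finally show "sum (dilated_weight r n) {..<N} \<le> 2 * exp 2 * real n / (r * (r - 1) * (r - 2))"
    by (simp add: mult_ac)
qed


text \<open>Splitting off the factor for k = 1 gives 1 + k/n = (1 + 1/n) (1 + y) with y = (k - 1) /
  (n + 1). Bernoulli and e >= n + 1 yield (1 + y) powr (e / p) >= 1 + (k - 1) / p >= k / p; the p-th
  power of this is decay of order p, uniform in e and n.\<close>

lemma dilated_powr_decay:
  fixes e :: real
  assumes n: "n \<ge> 1" and k: "k \<ge> 1" and e: "real n + 1 \<le> e" "real p \<le> e" and p: "p \<ge> 1"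
  shows "(1 + real k / real n) powr (-e) \<le> (1 + 1 / real n) powr (-e) * (real p / real k) ^ p"
proof -
  define y where "y = (real k - 1) / (real n + 1)"
  have y: "y \<ge> 0" using k by (simp add: y_def)
  have split: "1 + real k / real n = (1 + 1 / real n) * (1 + y)"
  proof -
    have "1 + y = (real n + real k) / (real n + 1)" by (simp add: y_def field_simps)
    moreover have "1 + 1 / real n = (real n + 1) / real n" "1 + real k / real n = (real n + real k) / real n"
      using n by (simp_all add: field_simps)
    moreover have "real n + 1 \<noteq> 0" by linarith
    ultimately show ?thesis by simp
  qed
  have "real k / real p \<le> 1 + e / p * y"
  proof -
    have "(real k - 1) / p = (real n + 1) / p * y" by (simp add: y_def)
    also have "\<dots> \<le> e / p * y" using e y p by (intro mult_right_mono divide_right_mono) auto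
    finally have "(real k - 1) / p \<le> e / p * y" .
    moreover have "real k / p \<le> 1 + (real k - 1) / p" using p by (simp add: field_simps)
    ultimately show ?thesis by linarith
  qed
  also have "\<dots> \<le> (1 + y) powr (e / p)"
    using e p y by (intro bernoulli_powr) auto
  finally have "(real k / real p) ^ p \<le> ((1 + y) powr (e / p)) ^ p"
    using p by (intro power_mono) auto
  also have "\<dots> = (1 + y) powr e"
    using y p by (simp add: powr_realpow[symmetric] powr_powr)
  finally have "(1 + y) powr (- e) \<le> (real p / real k) ^ p"
    using k p y by (simp add: powr_minus power_divide field_simps)
  thus ?thesis unfolding split using y by (simp add: powr_mult mult_left_mono)
qed

lemma summable_inverse_squares_Suc: "summable (\<lambda>k. 1 / (real (Suc k))\<^sup>2)"
  using sums_summable[OF inverse_squares_sums] by (simp add: add.commute)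

lemma suminf_inverse_squares_Suc: "(\<Sum>k. 1 / (real (Suc k))\<^sup>2) \<le> 2"
proof -
  have "(\<Sum>k. 1 / (real (Suc k))\<^sup>2) = pi\<^sup>2 / 6"
    using sums_unique[OF inverse_squares_sums] by (simp add: add.commute)
  moreover have "pi * pi \<le> 3.15 * 3.15" using pi_approx by (intro mult_mono) auto
  ultimately show ?thesis by (simp add: power2_eq_square)
qed

lemma suminf_le_inverse_squares:
  fixes f :: "nat \<Rightarrow> real"
  assumes "summable f" "\<And>k. f k \<le> c * (1 / (real (Suc k))\<^sup>2)" "c \<ge> 0"
  shows "suminf f \<le> 2 * c"
proof -
  have "suminf f \<le> (\<Sum>k. c * (1 / (real (Suc k))\<^sup>2))"
    by (intro suminf_le assms summable_mult summable_inverse_squares_Suc)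
  also have "\<dots> = c * (\<Sum>k. 1 / (real (Suc k))\<^sup>2)"
    by (rule suminf_mult[OF summable_inverse_squares_Suc])
  also have "\<dots> \<le> c * 2"
    using suminf_inverse_squares_Suc assms(3) by (intro mult_left_mono)
  finally show ?thesis by simp
qed

lemma sum_dilated_powr_large:
  assumes n: "n \<ge> 2" and r: "(real n)\<^sup>2 \<le> r"
  shows "(\<Sum>k. (1 + real (Suc k) / real n) powr (-r)) \<le> 8 * (1 + 1 / real n) powr (-r)"
proof -
  have "real n + 1 \<le> 2 * real n" using n by simp
  also have "\<dots> \<le> (real n)\<^sup>2" using n by (simp add: power2_eq_square)
  finally have rn: "real n + 1 \<le> r" using r by simp
  hence r2: "r > 2" using n by simp
  \<comment> \<open>Order p = 2 suffices for summability; the 4 is p^p, and the sum of inverse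
    squares contributes the factor 2.\<close>
  have "(1 + real (Suc k) / real n) powr (-r) \<le> 4 * (1 + 1 / real n) powr (-r) * (1 / (real (Suc k))\<^sup>2)" for k
    using dilated_powr_decay[of n "Suc k" r 2] n rn r2 by (simp add: power_divide algebra_simps)
  moreover have "summable (\<lambda>k. (1 + real (Suc k) / real n) powr (-r))"
    using summable_ignore_initial_segment[OF summable_dilated_powr[of r n], of 1] r2 n by simp
  ultimately have "(\<Sum>k. (1 + real (Suc k) / real n) powr (-r)) \<le> 2 * (4 * (1 + 1 / real n) powr (-r))"
    by (intro suminf_le_inverse_squares) auto
  thus ?thesis by simp
qed

text \<open>The term k = 1 dominates. Replacing (1 + 1/n) powr (-r) by exp (-r/n) costs at most exp
  (r / n^2) <= exp 1, since ln (1 + 1/n) >= 1/n - 1/n^2; this is where r <= n^2 enters.\<close>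

lemma sum_dilated_weight_medium:
  assumes n: "n \<ge> 2" and r: "real n + 1 \<le> r" "r \<le> (real n)\<^sup>2"
  shows "suminf (dilated_weight r n) \<le> 512 * exp 1 * (exp (- r / real n) / (real n)\<^sup>2)"
proof -
  define c where "c = (1 + 1 / real n) powr (-(r + 1)) / (real n)\<^sup>2"
  have r2: "r > 2" using n r by simp
  have summ: "summable (dilated_weight r n)" using summable_dilated_weight[OF r2] n by simp
  \<comment> \<open>The weight grows like k^2, so decay of order p = 4 is taken to leave an inverse
    square; 256 = 4^4, and p <= r + 1 holds because r >= n + 1 >= 3.\<close>
  have "dilated_weight r n (Suc k) \<le> 256 * c * (1 / (real (Suc k))\<^sup>2)" for k
  proof -
    have "(1 + real (Suc k) / real n) powr (-(r + 1)) \<le>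
        (1 + 1 / real n) powr (-(r + 1)) * (real 4 / real (Suc k)) ^ 4"
      using n r by (intro dilated_powr_decay) auto
    hence "dilated_weight r n (Suc k) \<le> (real (Suc k) / real n)\<^sup>2 *
        ((1 + 1 / real n) powr (-(r + 1)) * (real 4 / real (Suc k)) ^ 4)"
      unfolding dilated_weight_def by (intro mult_left_mono) auto
    also have "\<dots> = 256 * c * (1 / (real (Suc k))\<^sup>2)"
      unfolding c_def by (simp add: field_simps power2_eq_square power4_eq_xxxx del: of_nat_Suc)
    finally show ?thesis .
  qed
  moreover have "summable (\<lambda>k. dilated_weight r n (Suc k))"
    using summable_ignore_initial_segment[OF summ, of 1] by simp
  ultimately have "(\<Sum>k. dilated_weight r n (Suc k)) \<le> 2 * (256 * c)"
    by (intro suminf_le_inverse_squares) (auto simp: c_def)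
  moreover have "suminf (dilated_weight r n) = (\<Sum>k. dilated_weight r n (Suc k))"
    using suminf_split_head[OF summ] by (simp add: dilated_weight_def)
  ultimately have W: "suminf (dilated_weight r n) \<le> 512 * c" by simp
  have ln: "1 / n - (1 / n)\<^sup>2 \<le> ln (1 + 1 / real n)"
    using n by (intro ln_one_plus_pos_lower_bound) auto
  have "(1 + 1 / real n) powr (-(r + 1)) \<le> (1 + 1 / real n) powr (- r)"
    by (intro powr_mono) auto
  also have "\<dots> = exp (- (r * ln (1 + 1 / real n)))"
  proof -
    have "1 + 1 / real n > 0" by (simp add: add_pos_nonneg)
    thus ?thesis by (simp add: powr_def)
  qed
  also have "\<dots> \<le> exp (1 - r / n)"
  proof -
    have "r * (1 / n - (1 / n)\<^sup>2) \<le> r * ln (1 + 1 / real n)"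
      using ln r2 by (intro mult_left_mono) auto
    moreover have "r * (1 / n)\<^sup>2 \<le> 1" using r n by (simp add: power_divide)
    ultimately show ?thesis by (simp add: right_diff_distrib)
  qed
  also have "\<dots> = exp 1 * exp (- r / n)" by (simp add: exp_add[symmetric])
  finally have "c \<le> exp 1 * exp (- r / n) / (real n)\<^sup>2"
    unfolding c_def by (rule divide_right_mono) simp
  with W show ?thesis by simp
qed

section \<open>Oscillation of the kernel tail\<close>

lemma kernel_tail_range:
  fixes r \<theta> :: real and n :: nat
  defines "T \<equiv> kernel_tail r \<theta> n"
  assumes "r > 1"
  shows "(\<And>s t. T s - T t \<le> X) \<Longrightarrow> Sup (range T) - Inf (range T) \<le> X"
    and "T s - T t \<le> Sup (range T) - Inf (range T)"
proof -
  define K where "K = (\<Sum>k. real (n + k) powr (-r))"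
  have K: "\<bar>T t\<bar> \<le> K" for t
    unfolding T_def K_def by (rule kernel_tail_bound[OF assms(2)])
  have bdd: "bdd_above (range T)" "bdd_below (range T)"
    using K by (auto intro!: bdd_aboveI[of _ K] bdd_belowI[of _ "-K"] simp: abs_le_iff minus_le_iff)
  show "T s - T t \<le> Sup (range T) - Inf (range T)"
    using bdd by (intro diff_mono cSup_upper cInf_lower) auto
  assume X: "\<And>s t. T s - T t \<le> X"
  have "Sup (range T) \<le> X + T t" for t
    using X[of _ t] by (intro cSup_least) (auto simp: algebra_simps)
  hence "Sup (range T) - X \<le> Inf (range T)"
    by (intro cInf_greatest) (auto simp: algebra_simps)
  thus "Sup (range T) - Inf (range T) \<le> X" by simp
qed

lemma kernel_tail_dilated:
  assumes "r > 1" "n \<ge> 1"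
  shows "(\<lambda>k. (1 + real k / real n) powr (-r) * cos (real (n + k) * t - \<theta>)) sums
           (real n powr r * kernel_tail r \<theta> n t)"
proof -
  have "(\<lambda>k. real n powr r * (real (n + k) powr (-r) * cos (real (n + k) * t - \<theta>))) sums
      (real n powr r * kernel_tail r \<theta> n t)"
    unfolding kernel_tail_def
    by (intro sums_mult summable_sums summable_kernel_terms assms)
  moreover have "real n powr r * (real (n + k) powr (-r) * y) = (1 + real k / real n) powr (-r) * y" for k :: nat and y
  proof -
    have "1 + real k / real n = real (n + k) / real n" using assms by (simp add: field_simps)
    thus ?thesis by (simp add: powr_divide powr_minus field_simps)
  qed
  ultimately show ?thesis by (simp only:)
qed

text \<open>The phase \<open>\<theta>\<close> is compensated at the frequency \<open>n\<close> by a shift of size at most \<open>pi / n\<close>.\<close>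

lemma kernel_tail_aligned:
  assumes r: "r > 1" and n: "n \<ge> 1"
  obtains t where "\<bar>t\<bar> \<le> pi / n"
    "(\<lambda>k. (1 + real k / real n) powr (-r) * cos (real k * t)) sums (real n powr r * kernel_tail r \<theta> n t)"
proof -
  \<comment> \<open>The integer nearest to \<theta> / (2 pi), so that the reduced phase is at most
    pi in absolute value.\<close>
  define j where "j = \<lfloor>(\<theta> + pi) / (2 * pi)\<rfloor>"
  define t where "t = (\<theta> - 2 * pi * of_int j) / n"
  have "of_int j \<le> (\<theta> + pi) / (2 * pi)" "(\<theta> + pi) / (2 * pi) < of_int j + 1"
    unfolding j_def by linarith+
  hence "\<bar>\<theta> - 2 * pi * of_int j\<bar> \<le> pi"
    by (auto simp: abs_le_iff field_simps)
  hence 1: "\<bar>t\<bar> \<le> pi / n" by (simp add: t_def abs_divide divide_right_mono)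
  have "cos (real (n + k) * t - \<theta>) = cos (real k * t)" for k
  proof -
    have "real n * t = \<theta> - 2 * pi * of_int j" using n by (simp add: t_def)
    hence "real (n + k) * t - \<theta> = real k * t - of_int j * (2 * pi)" by (simp add: algebra_simps)
    thus ?thesis using cos.minus_of_int[of "real k * t" j] by simp
  qed
  with kernel_tail_dilated[OF r n, of t \<theta>] 1 that show thesis by simp
qed

text \<open>Aligning the phase \<theta> + pi therefore produces a point where the tail with phase
  \<theta> is nearly minimal, so one alignment lemma serves both ends of the range.\<close>

lemma kernel_tail_half_turn:
  assumes "r > 1"
  shows "kernel_tail r (\<theta> + pi) n t = - kernel_tail r \<theta> n t"
proof -
  have "cos (x - (\<theta> + pi)) = - cos (x - \<theta>)" for x
    using cos_minus_pi[of "x - \<theta>"] by (simp add: algebra_simps)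
  thus ?thesis
    using suminf_minus[OF summable_kernel_terms(1)[OF assms, of n "\<lambda>k. real (n + k) * t - \<theta>"]]
    by (simp add: kernel_tail_def)
qed

text \<open>The majorant l of the phase loss is left open because the regimes need different ones: a
  multiple of \<open>dilated_weight\<close> in general, and twice the coefficients with k >= 1 when
  r >= n^2.\<close>

lemma kernel_tail_oscillation:
  fixes r \<theta> :: real and n :: nat
  defines "T \<equiv> kernel_tail r \<theta> n"
    and "a \<equiv> \<lambda>k. (1 + real k / real n) powr (-r)"
  defines "V \<equiv> real n powr r * (Sup (range T) - Inf (range T)) / 2"
  assumes r: "r > 1" and n: "n \<ge> 1"
  shows "V \<le> suminf a"
    and "(\<And>k t. \<bar>t\<bar> \<le> pi / n \<Longrightarrow> a k * (1 - cos (real k * t)) \<le> l k) \<Longrightarrow> summable l \<Longrightarrow>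
           suminf a - suminf l \<le> V"
proof -
  have summ: "summable a" unfolding a_def by (rule summable_dilated_powr[OF r n])
  have npos: "real n powr r > 0" using n by simp
  have bound: "\<bar>real n powr r * kernel_tail r \<theta>' n t\<bar> \<le> suminf a" for \<theta>' t
  proof -
    from kernel_tail_dilated[OF r n, of t \<theta>']
    have "real n powr r * kernel_tail r \<theta>' n t = (\<Sum>k. a k * cos (real (n + k) * t - \<theta>'))"
      by (simp add: sums_iff a_def)
    moreover have "norm (\<Sum>k. a k * cos (real (n + k) * t - \<theta>')) \<le> suminf a"
      by (rule norm_suminf_le[OF _ summ]) (auto simp: a_def abs_mult mult_left_le)
    ultimately show ?thesis by simp
  qed
  have "T s - T t \<le> 2 * suminf a / real n powr r" for s t
  proof -
    have "real n powr r * (T s - T t) \<le> 2 * suminf a"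
      using bound[of \<theta> s] bound[of \<theta> t] unfolding T_def right_diff_distrib abs_le_iff by linarith
    thus ?thesis using npos by (simp add: pos_le_divide_eq mult.commute)
  qed
  from kernel_tail_range(1)[OF r this[unfolded T_def]]
  show "V \<le> suminf a" using npos unfolding V_def T_def by (simp add: pos_le_divide_eq mult.commute)
  assume l: "\<And>k t. \<bar>t\<bar> \<le> pi / n \<Longrightarrow> a k * (1 - cos (real k * t)) \<le> l k" and l_summ: "summable l"
  have low: "\<exists>t. suminf a - suminf l \<le> real n powr r * kernel_tail r \<theta>' n t" for \<theta>'
  proof -
    obtain t where t: "\<bar>t\<bar> \<le> pi / n"
      "(\<lambda>k. a k * cos (real k * t)) sums (real n powr r * kernel_tail r \<theta>' n t)"
      using kernel_tail_aligned[OF r n] unfolding a_def by blast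
    have "suminf a - suminf l = (\<Sum>k. a k - l k)" by (rule suminf_diff[OF summ l_summ])
    also have "\<dots> \<le> (\<Sum>k. a k * cos (real k * t))"
      using l[OF t(1)] t(2)
      by (intro suminf_le summable_diff summ l_summ) (auto simp: algebra_simps sums_iff)
    finally show ?thesis using t(2) by (auto simp: sums_iff)
  qed
  from low[of \<theta>] obtain s where s: "suminf a - suminf l \<le> real n powr r * T s"
    unfolding T_def by blast
  from low[of "\<theta> + pi"] obtain t where t: "suminf a - suminf l \<le> - (real n powr r * T t)"
    unfolding T_def kernel_tail_half_turn[OF r] by auto
  have "real n powr r * (T s - T t) \<le> real n powr r * (Sup (range T) - Inf (range T))"
    using npos kernel_tail_range(2)[OF r, of \<theta> n s t] unfolding T_def by (intro mult_left_mono) auto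
  with s t show "suminf a - suminf l \<le> V" unfolding V_def by (simp add: right_diff_distrib)
qed

section \<open>Distance between the oscillation and the geometric sum\<close>

lemma geometric_exp:
  assumes "r > 0" "n \<ge> 1"
  shows "(\<lambda>k. exp (- r / real n) ^ k) sums (1 / (1 - exp (- r / real n)))"
  using assms by (intro geometric_sums) simp

text \<open>The sum of the coefficients lies above both quantities: by at most 10 W for the
  oscillation (phase loss) and by at most r W for the geometric sum, W being the sum of weights.
  Since r > 2, 10 W <= 5 r W.\<close>

lemma oscillation_weight_bound:
  fixes r \<theta> :: real and n :: nat
  defines "T \<equiv> kernel_tail r \<theta> n"
  assumes r: "r > 2" and n: "n \<ge> 1"
  shows "\<bar>real n powr r * (Sup (range T) - Inf (range T)) / 2 - 1 / (1 - exp (- r / real n))\<bar>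
           \<le> 6 * r * suminf (dilated_weight r n)"
proof -
  define a where "a k = (1 + real k / real n) powr (-r)" for k
  define W where "W = suminf (dilated_weight r n)"
  define V where "V = real n powr r * (Sup (range T) - Inf (range T)) / 2"
  have r1: "r > 1" using r by simp
  note w_summ = summable_dilated_weight[OF r n]
  have a_summ: "summable a" unfolding a_def by (rule summable_dilated_powr[OF r1 n])
  note geo = geometric_exp[of r n]
  have W0: "W \<ge> 0" unfolding W_def using dilated_weight_nonneg by (intro suminf_nonneg w_summ)
  have 1: "V \<le> suminf a"
    unfolding V_def T_def a_def[abs_def] by (rule kernel_tail_oscillation(1)[OF r1 n])
  have "suminf a - (\<Sum>k. 10 * dilated_weight r n k) \<le> V"
    unfolding V_def T_def a_def[abs_def]
  proof (rule kernel_tail_oscillation(2)[OF r1 n])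
    show "summable (\<lambda>k. 10 * dilated_weight r n k)" by (intro summable_mult w_summ)
    fix k and t :: real assume t: "\<bar>t\<bar> \<le> pi / n"
    have "\<bar>real k * t\<bar> \<le> pi * (real k / real n)"
      using mult_left_mono[OF t, of "real k"] by (simp add: abs_mult mult.commute)
    from mult_left_mono[OF one_minus_cos_le[OF this], of "(1 + real k / real n) powr (-r)"]
    show "(1 + real k / real n) powr (-r) * (1 - cos (real k * t)) \<le> 10 * dilated_weight r n k"
      unfolding dilated_weight_eq by (simp add: mult.commute mult.left_commute)
  qed
  hence 2: "suminf a - 10 * W \<le> V" unfolding W_def using suminf_mult[OF w_summ, of 10] by simp
  have 3: "1 / (1 - exp (- r / real n)) \<le> suminf a"
    using geo dilated_powr_exp_diff(1)[where r = r and n = n] r n a_summ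
    by (subst sums_unique[of _ "1 / (1 - exp (- r / real n))"], simp)
       (intro suminf_le, auto simp: sums_iff a_def)
  have "suminf a - 1 / (1 - exp (- r / real n)) = (\<Sum>k. a k - exp (- r / real n) ^ k)"
    using geo r n suminf_diff[OF a_summ, of "\<lambda>k. exp (- r / real n) ^ k"] by (simp add: sums_iff)
  also have "\<dots> \<le> (\<Sum>k. r * dilated_weight r n k)"
    using geo r n dilated_powr_exp_diff(2)[where r = r and n = n]
    by (intro suminf_le summable_diff a_summ summable_mult w_summ) (auto simp: sums_iff a_def)
  also have "\<dots> = r * W" unfolding W_def by (rule suminf_mult[OF w_summ])
  finally have 4: "suminf a - 1 / (1 - exp (- r / real n)) \<le> r * W" .
  have "10 * W \<le> 5 * r * W" using r W0 by (intro mult_right_mono) auto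
  moreover have "0 \<le> r * W" using r W0 by simp
  ultimately have "\<bar>V - 1 / (1 - exp (- r / real n))\<bar> \<le> 6 * (r * W)"
    unfolding abs_le_iff using 1 2 3 4 by linarith
  thus ?thesis by (simp add: V_def W_def)
qed

text \<open>With A the sum of the coefficients for k >= 1, the oscillation term lies in
  [1 - A, 1 + A] and the geometric sum in [1, 1 + A]. A itself is of the order of its first
  term.\<close>

lemma oscillation_large:
  fixes r \<theta> :: real and n :: nat
  defines "T \<equiv> kernel_tail r \<theta> n"
  assumes n: "n \<ge> 2" and rn: "(real n)\<^sup>2 \<le> r"
  shows "\<bar>real n powr r * (Sup (range T) - Inf (range T)) / 2 - 1 / (1 - exp (- r / real n))\<bar>
           \<le> 16 * (1 + 1 / real n) powr (-r)"
proof -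
  define a where "a k = (1 + real k / real n) powr (-r)" for k
  define V where "V = real n powr r * (Sup (range T) - Inf (range T)) / 2"
  have "(2::real)\<^sup>2 \<le> (real n)\<^sup>2" using n by (intro power_mono) auto
  with rn have r1: "r > 1" by simp
  have n1: "n \<ge> 1" using n by simp
  have a_summ: "summable a" unfolding a_def by (rule summable_dilated_powr[OF r1 n1])
  hence a_summ': "summable (\<lambda>k. a (Suc k))" by (subst summable_Suc_iff)
  define A where "A = (\<Sum>k. a (Suc k))"
  have A0: "0 \<le> A" unfolding A_def by (intro suminf_nonneg a_summ') (simp add: a_def)
  have sa: "suminf a = 1 + A"
    using suminf_split_head[OF a_summ] by (simp add: A_def a_def)
  have 1: "V \<le> suminf a"
    unfolding V_def T_def a_def[abs_def] by (rule kernel_tail_oscillation(1)[OF r1 n1])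
  \<comment> \<open>The term k = 0 suffers no phase loss, and every other factor 1 - cos is at most
    2.\<close>
  define l where "l k = (if k = 0 then 0 else 2 * a k)" for k
  have l_summ: "summable l"
    using summable_mult[OF a_summ', of 2] summable_Suc_iff[of l] by (simp add: l_def)
  have "suminf a - suminf l \<le> V"
    unfolding V_def T_def a_def[abs_def]
  proof (rule kernel_tail_oscillation(2)[OF r1 n1 _ l_summ])
    fix k and t :: real
    have "(1 - cos (real k * t)) \<le> 2" using cos_ge_minus_one[of "real k * t"] by linarith
    from mult_left_mono[OF this, of "a k"]
    show "(1 + real k / real n) powr (-r) * (1 - cos (real k * t)) \<le> l k"
      by (auto simp: l_def a_def mult.commute)
  qed
  moreover have "suminf l = 2 * A"
    using suminf_split_head[OF l_summ] suminf_mult[OF a_summ', of 2] by (simp add: l_def A_def)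
  ultimately have 2: "1 - A \<le> V" using sa by simp
  have q: "exp (- r / real n) < 1" using r1 n1 by simp
  have 3: "1 / (1 - exp (- r / real n)) \<le> suminf a"
    using geometric_exp[of r n] dilated_powr_exp_diff(1)[where r = r and n = n] r1 n1 a_summ
    by (subst sums_unique[of _ "1 / (1 - exp (- r / real n))"], simp)
       (intro suminf_le, auto simp: sums_iff a_def)
  have 4: "1 \<le> 1 / (1 - exp (- r / real n))" using q by (simp add: field_simps)
  have "\<bar>V - 1 / (1 - exp (- r / real n))\<bar> \<le> 2 * A"
    unfolding abs_le_iff using 1 2 3 4 sa by linarith
  also have "\<dots> \<le> 2 * (8 * (1 + 1 / real n) powr (-r))"
    using sum_dilated_powr_large[OF n rn] unfolding A_def a_def by simp
  finally show ?thesis by (simp add: V_def)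
qed


text \<open>For \<open>n = 1\<close> the second harmonic has size \<open>2 powr (-r)\<close>, which exceeds the admitted error \<open>exp (-r)\<close>.
  It cancels to first order in \<open>T s - T t\<close>, because the first harmonic is extremal at points at distance
  \<open>pi\<close>, where the second one takes equal values.\<close>

lemma oscillation_first_order:
  fixes r \<theta> :: real
  defines "T \<equiv> kernel_tail r \<theta> 1"
  assumes r: "r > 2"
  shows "\<bar>(Sup (range T) - Inf (range T)) / 2 - 1 / (1 - exp (- r))\<bar> \<le> 22 * exp (- r)"
proof -
  define V where "V = (Sup (range T) - Inf (range T)) / 2"
  define \<epsilon> where "\<epsilon> = 2 powr (- r)"
  define B where "B = (\<Sum>k. real (3 + k) powr (- r))"
  have r1: "r > 1" using r by simp
  have T_eq: "T t = cos (t - \<theta>) + \<epsilon> * cos (2 * t - \<theta>) + kernel_tail r \<theta> 3 t" for t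
    using suminf_split_initial_segment[OF summable_kernel_terms(1)[OF r1, of 1 "\<lambda>k. real (1 + k) * t - \<theta>"], of 2]
    by (simp add: T_def kernel_tail_def \<epsilon>_def numeral_2_eq_2 numeral_3_eq_3 add_ac)
  have tail: "\<bar>kernel_tail r \<theta> 3 t\<bar> \<le> B" for t
    unfolding B_def by (rule kernel_tail_bound[OF r1])
  have e3: "exp (1::real) \<le> 3" by (rule exp_le)
  have pow: "x powr (- r) \<le> exp (- r)" if "x \<ge> 3" for x
  proof -
    have "exp 1 \<le> x" using that e3 by linarith
    hence "1 \<le> ln x" using that by (subst ln_ge_iff) auto
    hence "r * 1 \<le> r * ln x" using r by (intro mult_left_mono) auto
    thus ?thesis using that by (simp add: powr_def)
  qed
  have B: "B \<le> 18 * exp (- r)"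
  proof -
    have "real (3 + k) powr (- r) \<le> 9 * exp (- r) * (1 / (real (Suc k))\<^sup>2)" for k
    proof -
      have "1 + real k / 3 \<ge> 1" by simp
      hence "(1 + real k / 3) powr (- r) \<le> (1 + real k / 3) powr (- 2)"
        using r by (intro powr_mono) auto
      also have "\<dots> = 1 / (1 + real k / 3)\<^sup>2"
        unfolding powr_minus inverse_eq_divide by (subst powr_numeral) auto
      also have "\<dots> \<le> 1 / (real (Suc k) / 3)\<^sup>2"
        by (intro divide_left_mono power_mono mult_pos_pos zero_less_power) (auto intro: add_pos_nonneg)
      also have "\<dots> = 9 / (real (Suc k))\<^sup>2" by (simp add: power_divide)
      finally have "3 powr (- r) * (1 + real k / 3) powr (- r) \<le> exp (- r) * (9 / (real (Suc k))\<^sup>2)"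
        using pow[of 3] by (intro mult_mono) auto
      also have "3 powr (- r) * (1 + real k / 3) powr (- r) = real (3 + k) powr (- r)"
        by (subst powr_mult[symmetric]) (simp add: algebra_simps)
      finally show ?thesis by (simp add: mult.commute)
    qed
    hence "B \<le> 2 * (9 * exp (- r))"
      unfolding B_def by (intro suminf_le_inverse_squares summable_powr_shift r1) auto
    thus ?thesis by simp
  qed
  \<comment> \<open>With p = \<bar>sin (u / 2)\<bar> and c = \<bar>cos (u / 2)\<bar>, the first two
    harmonics contribute at most 2 p and 4 \<epsilon> c. As p^2 + c^2 = 1, adding the squares of 1 -
    p and c - 2 \<epsilon> gives 2 p + 4 \<epsilon> c <= 2 + 4 \<epsilon>^2: the second harmonic
    enters only through \<epsilon>^2 = 4 powr (-r), which is at most exp (-r).\<close>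
  have "T s - T t \<le> 2 + 4 * \<epsilon>\<^sup>2 + 2 * B" for s t
  proof -
    define u where "u = s - t"
    define v where "v = s + t"
    have e1: "(s - \<theta> + (t - \<theta>)) / 2 = v / 2 - \<theta>" "(t - \<theta> - (s - \<theta>)) / 2 = - (u / 2)"
      by (simp_all add: u_def v_def field_simps)
    have d1: "cos (s - \<theta>) - cos (t - \<theta>) = - 2 * sin (v / 2 - \<theta>) * sin (u / 2)"
      unfolding cos_diff_cos e1 by simp
    have e2: "(2 * s - \<theta> + (2 * t - \<theta>)) / 2 = v - \<theta>" "(2 * t - \<theta> - (2 * s - \<theta>)) / 2 = - u"
      by (simp_all add: u_def v_def field_simps)
    have d2: "cos (2 * s - \<theta>) - cos (2 * t - \<theta>) = - 4 * sin (v - \<theta>) * (sin (u / 2) * cos (u / 2))"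
      unfolding cos_diff_cos e2 using sin_double[of "u / 2"] by simp
    define p where "p = \<bar>sin (u / 2)\<bar>"
    define c where "c = \<bar>cos (u / 2)\<bar>"
    have pc: "p\<^sup>2 + c\<^sup>2 = 1" by (simp add: p_def c_def)
    have p: "0 \<le> p" "p \<le> 1" and c: "0 \<le> c" by (auto simp: p_def c_def)
    have "\<bar>cos (s - \<theta>) - cos (t - \<theta>)\<bar> \<le> 2 * p"
      unfolding d1 p_def by (simp add: abs_mult mult_left_le_one_le)
    moreover have "\<bar>cos (2 * s - \<theta>) - cos (2 * t - \<theta>)\<bar> \<le> 4 * (p * c)"
      unfolding d2 p_def c_def by (simp add: abs_mult mult_left_le_one_le)
    moreover have "4 * (p * c) \<le> 4 * (1 * c)" using p c by (intro mult_left_mono mult_right_mono) auto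
    ultimately have "\<epsilon> * (cos (2 * s - \<theta>) - cos (2 * t - \<theta>)) \<le> \<epsilon> * (4 * c)"
      by (intro mult_left_mono) (auto simp: \<epsilon>_def abs_le_iff)
    moreover have "cos (s - \<theta>) - cos (t - \<theta>) \<le> 2 * p" using \<open>\<bar>cos (s - \<theta>) - _\<bar> \<le> 2 * p\<close> by simp
    moreover have "2 * p + \<epsilon> * (4 * c) \<le> 2 + 4 * \<epsilon>\<^sup>2"
    proof -
      have "0 \<le> (1 - p)\<^sup>2" "0 \<le> (c - 2 * \<epsilon>)\<^sup>2" by simp_all
      with pc show ?thesis by (simp add: power2_eq_square algebra_simps)
    qed
    ultimately show ?thesis
      unfolding T_eq using tail[of s] tail[of t] by (simp add: abs_le_iff algebra_simps)
  qed
  from kernel_tail_range(1)[OF r1 this[unfolded T_def]]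
  have 1: "V \<le> 1 + 2 * \<epsilon>\<^sup>2 + B" unfolding V_def T_def by simp
  have "T \<theta> - T (\<theta> + pi) \<le> 2 * V"
    using kernel_tail_range(2)[OF r1, of \<theta> 1 \<theta> "\<theta> + pi"] unfolding V_def T_def by simp
  moreover have "T \<theta> - T (\<theta> + pi) \<ge> 2 - 2 * B"
  proof -
    have "cos (2 * (\<theta> + pi) - \<theta>) = cos \<theta>"
      using cos.plus_1[of \<theta>] by (simp add: algebra_simps)
    thus ?thesis unfolding T_eq using tail[of \<theta>] tail[of "\<theta> + pi"] by (simp add: abs_le_iff)
  qed
  ultimately have 2: "1 - B \<le> V" by simp
  have eps: "\<epsilon>\<^sup>2 \<le> exp (- r)"
  proof -
    have "\<epsilon>\<^sup>2 = 4 powr (- r)"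
      unfolding \<epsilon>_def power2_eq_square by (subst powr_mult[symmetric]) simp
    thus ?thesis using pow[of 4] by simp
  qed
  define q where "q = exp (- r)"
  have "q \<le> exp (- 1)" using r by (simp add: q_def)
  also have "exp (- 1 :: real) \<le> 1 / 2"
    using exp_ge_add_one_self[of 1] by (simp add: exp_minus field_simps)
  finally have q: "0 < q" "q \<le> 1 / 2" by (auto simp: q_def)
  have "1 / (1 - q) \<le> 1 + 2 * q"
  proof -
    have "0 \<le> q * (1 - 2 * q)" using q by (intro mult_nonneg_nonneg) auto
    thus ?thesis using q by (simp add: divide_le_eq algebra_simps)
  qed
  moreover have "1 \<le> 1 / (1 - q)" using q by (simp add: field_simps)
  \<comment> \<open>The budget 22 consists of 2 for \<epsilon>, 18 for B and 2 for the geometric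
    sum.\<close>
  ultimately have "\<bar>V - 1 / (1 - q)\<bar> \<le> 22 * q"
    unfolding abs_le_iff using 1 2 eps B q unfolding q_def[symmetric] by linarith
  thus ?thesis by (simp add: V_def q_def)
qed

lemma remainder_order_pos:
  assumes "remainder_order r n \<delta>"
  shows "\<delta> > 0"
  using assms
proof cases
  case small
  thus ?thesis by simp
next
  case medium
  hence "r > 0" by linarith
  thus ?thesis using medium by simp
next
  case large
  have "1 + 1 / real n > 0" by (simp add: add_pos_nonneg)
  thus ?thesis using large by simp
qed simp

text \<open>The cases yield the constants 22, 24 exp 2, 3072 exp 1 and 16; the stated one exceeds
  them all. At the overlapping endpoints each admissible \<delta> is treated by its own
  case.\<close>

lemma oscillation_remainder:
  fixes r \<theta> :: real and n :: nat
  defines "T \<equiv> kernel_tail r \<theta> n"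
  assumes r: "r > 2" and \<delta>: "remainder_order r n \<delta>"
  shows "\<bar>real n powr r * (Sup (range T) - Inf (range T)) / 2 - 1 / (1 - exp (- r / real n))\<bar>
           \<le> 3072 * exp 2 * \<delta>"
proof -
  define X where "X = \<bar>real n powr r * (Sup (range T) - Inf (range T)) / 2 - 1 / (1 - exp (- r / real n))\<bar>"
  have e: "1 \<le> exp (2::real)" "exp (1::real) \<le> exp 2" by simp_all
  have \<delta>0: "\<delta> > 0" by (rule remainder_order_pos[OF \<delta>])
  have suff: "X \<le> 3072 * exp 2 * \<delta>" if "X \<le> c * \<delta>" "c \<le> 3072 * exp 2" for c
    by (rule order_trans[OF that(1) mult_right_mono[OF that(2)]]) (use \<delta>0 in simp)
  from \<delta> have "X \<le> 3072 * exp 2 * \<delta>"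
  proof cases
    case one
    have "X \<le> 22 * \<delta>"
      using oscillation_first_order[OF r, of \<theta>] one by (simp add: X_def T_def)
    thus ?thesis by (rule suff) (use e in linarith)
  next
    case small
    have "X \<le> 6 * r * suminf (dilated_weight r n)"
      unfolding X_def T_def using small by (intro oscillation_weight_bound) auto
    also have "\<dots> \<le> 6 * r * (2 * exp 2 * real n / (r * (r - 1) * (r - 2)))"
      using small by (intro mult_left_mono sum_dilated_weight_small) auto
    also have "\<dots> = 12 * exp 2 * (real n / ((r - 1) * (r - 2)))"
      using r by (simp add: mult.assoc)
    also have "\<dots> \<le> 12 * exp 2 * (2 * \<delta>)"
    proof (rule mult_left_mono)
      \<comment> \<open>From r <= 2 (r - 1): this trades the factor r - 1 left by the Beta integral
        for the r in \<delta>.\<close>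
      have "r * (r - 2) \<le> 2 * ((r - 1) * (r - 2))"
        unfolding mult.assoc[symmetric] using r by (intro mult_right_mono) auto
      hence "2 * real n / (2 * ((r - 1) * (r - 2))) \<le> 2 * real n / (r * (r - 2))"
        using r by (intro divide_left_mono mult_pos_pos) auto
      also have "2 * real n / (2 * ((r - 1) * (r - 2))) = real n / ((r - 1) * (r - 2))" by simp
      finally show "real n / ((r - 1) * (r - 2)) \<le> 2 * \<delta>" using small by simp
    qed simp
    finally have "X \<le> (24 * exp 2) * \<delta>" by simp
    thus ?thesis by (rule suff) simp
  next
    case medium
    have "X \<le> 6 * r * suminf (dilated_weight r n)"
      unfolding X_def T_def using medium r by (intro oscillation_weight_bound) auto
    also have "\<dots> \<le> 6 * r * (512 * exp 1 * (exp (- r / real n) / (real n)\<^sup>2))"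
      using medium r by (intro mult_left_mono sum_dilated_weight_medium) auto
    also have "\<dots> = (3072 * exp 1) * \<delta>" using medium by simp
    finally show ?thesis by (rule suff) simp
  next
    case large
    have "X \<le> 16 * \<delta>"
      unfolding X_def T_def using oscillation_large[of n r \<theta>] large by simp
    thus ?thesis by (rule suff) (use e in linarith)
  qed
  thus ?thesis by (simp add: X_def)
qed

theorem theorem3:
  shows "\<exists>C>0. \<forall>(r::real) (\<beta>::real) (n::nat) (\<delta>::real).
    2 < r \<longrightarrow> 1 \<le> n \<longrightarrow> remainder_order r n \<delta> \<longrightarrow>
    (\<exists>\<eta>::real. \<bar>\<eta>\<bar> \<le> C \<and>
      (\<forall>x. fourier_sup_deviation n (weyl_nagy_class r \<beta>) x =
        ereal (1 / real n powr r * (1 / (pi * (1 - exp (- r / real n))) + \<eta> * \<delta>))))"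
proof (rule exI[of _ "3072 * exp 2"], intro conjI allI impI)
  fix r \<beta> :: real and n :: nat and \<delta> :: real
  assume r: "2 < r" and n: "1 \<le> n" and \<delta>: "remainder_order r n \<delta>"
  define T where "T = kernel_tail r (\<beta> * pi / 2) n"
  define D where "D = Sup (range T) - Inf (range T)"
  define E where "E = real n powr r * D / 2 - 1 / (1 - exp (- r / real n))"
  \<comment> \<open>The supremum is D / (2 pi) while E measures the error of n^r D / 2, hence the
    extra factor pi.\<close>
  define \<eta> where "\<eta> = E / (pi * \<delta>)"
  have \<delta>0: "\<delta> > 0" by (rule remainder_order_pos[OF \<delta>])
  have "\<bar>E\<bar> \<le> 3072 * exp 2 * \<delta>"
    unfolding E_def D_def T_def by (rule oscillation_remainder[OF r \<delta>])
  also have "\<dots> \<le> 3072 * exp 2 * \<delta> * pi"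
    using \<delta>0 pi_gt3 by (simp add: mult_le_cancel_left1 not_less)
  finally have "\<bar>\<eta>\<bar> \<le> 3072 * exp 2"
    using \<delta>0 by (simp add: \<eta>_def abs_mult divide_le_eq mult_ac)
  moreover have "fourier_sup_deviation n (weyl_nagy_class r \<beta>) x =
      ereal (1 / real n powr r * (1 / (pi * (1 - exp (- r / real n))) + \<eta> * \<delta>))" for x
  proof -
    have "1 / (pi * (1 - exp (- r / real n))) + \<eta> * \<delta> = (1 / (1 - exp (- r / real n)) + E) / pi"
      using \<delta>0 by (simp add: \<eta>_def add_divide_distrib mult.commute)
    also have "\<dots> = real n powr r * (D / (2 * pi))" by (simp add: E_def)
    finally have "1 / real n powr r * (1 / (pi * (1 - exp (- r / real n))) + \<eta> * \<delta>) = D / (2 * pi)"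
      using n by simp
    thus ?thesis
      using fourier_sup_deviation_weyl_nagy[of r n \<beta> x] r n by (simp add: D_def T_def)
  qed
  ultimately show "\<exists>\<eta>. \<bar>\<eta>\<bar> \<le> 3072 * exp 2 \<and>
      (\<forall>x. fourier_sup_deviation n (weyl_nagy_class r \<beta>) x =
        ereal (1 / real n powr r * (1 / (pi * (1 - exp (- r / real n))) + \<eta> * \<delta>)))"
    by blast
qed simp

end
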